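(* Let $n\ge3$, let $L>0$ be a pseudo-Riemannian pseudo-Finsler metric on $A$ and let $\mathrm{N}$ be a linear nonlinear connection on $A$. Then $\mathrm{N}$ is a solution of the affine equation of $L$ if and only if $$\mathrm{N}=\mathrm{N}^L+\mathcal{A}\otimes\mathbb{C}$$ for some isotropic $1$-form $\mathcal{A}$. For these connections, $\mathrm{Ric}=\mathrm{Ric}^L$, and $(\mathrm{N},L)$ also solves the metric equation $$(n+2)\,\mathrm{Ric}-L\,g^{ab}\,\mathrm{Ric}_{\cdot a\cdot b}=0$$ if and only if $L$ solves the classical (vacuum) Einstein equation $\mathrm{Ric}^L=0$.
   Context: $M$ is a connected smooth manifold of dimension $n$, $\pi:TM\to M$ the projection. Charts $(x^i)$ of $M$ induce charts $(x^i,y^i)$ of $TM$; $\partial_i=\partial/\partial x^i$, $\dot\partial_i=\partial/\partial y^i$; repeated indices are summed; a subscript $\cdot i$ denotes $\dot\partial_i$. $A\subseteq TM\setminus\mathbf{0}$ is open and conic ($\lambda v\in A$ for $v\in A$, $\lambda>0$) with $\pi(A)=M$. An anisotropic tensor of type $(r,s)$ is a smooth section of the pullback to $A$ of $\bigotimes^rTM\otimes\bigotimes^sT^*M$, with components $T^{i_1\dots i_r}_{j_1\dots j_s}(x,y)$; it is isotropic if the components depend only on $x$. The space of those with components positively $\alpha$-homogeneous in $y$ is $\mathrm{h}^\alpha\mathcal{T}^r_s(M_A)$. $\mathbb{C}=y^a\partial_a$, $(\mathcal{A}\otimes\mathbb{C})_i^k=\mathcal{A}_iy^k$. A homogeneous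 nonlinear connection $\mathrm{N}$ on $A$ is given in each chart by smooth functions $\mathrm{N}_i^k(x,y)$, positively $1$-homogeneous in $y$, transforming by $\bar{\mathrm{N}}_i^k=\frac{\partial\bar x^k}{\partial x^c}\frac{\partial^2x^c}{\partial\bar x^i\partial\bar x^b}\bar y^b+\frac{\partial\bar x^k}{\partial x^c}\frac{\partial x^a}{\partial\bar x^i}\mathrm{N}_a^c$. Differences of two such lie in $\mathrm{h}^1\mathcal{T}^1_1(M_A)$. It is linear if $\mathrm{N}_i^k(x,y)=\Gamma_{ia}^k(x)y^a$ for some functions $\Gamma_{ij}^k(x)$ (necessarily the Christoffel symbols of an affine connection on $M$). With $\delta_i=\partial_i-\mathrm{N}_i^a\dot\partial_a$: $\mathcal{R}_{ij}^k=\delta_j\mathrm{N}_i^k-\delta_i\mathrm{N}_j^k$ and the Ricci scalar is $\mathrm{Ric}=y^b\mathcal{R}_{ba}^a$. A pseudo-Finsler metric on $A$ is a smooth positively $2$-homogeneous $L:A\to\mathbb{R}$ with $g_{ij}=\frac12L_{\cdot i\cdot j}$ non-degenerate everywhere; here $L>0$ on $A$. It is pseudo-Riemannian if $g$ is isotropic, i.e. a pseudo-Riemannian metric on $M$, and $L=g_{ab}(x)y^ay^b$. Indices are moved with $g$; $y_i=g_{ia}y^a$. $(\mathrm{G}^L)^i=\frac14g^{ia}(2\partial_cg_{ab}-\partial_ag_{bc})y^by^c$; $(\mathrm{N}^L)_i^k=\dot\partial_i(\mathrm{G}^L)^k$; $\mathrm{Ric}^L$ is the Ricci scalar of $\mathrm{N}^L$.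 $\mathrm{C}_{ijk}=\frac12g_{ij\cdot k}$, $\mathrm{C}_i=g^{ab}\mathrm{C}_{abi}$. $\mathrm{Lan}_{ijk}=\frac12\nabla^L_kg_{ij}$ with $\nabla^L_kg_{ij}=(\partial_k-(\mathrm{N}^L)_k^a\dot\partial_a)g_{ij}-(\mathrm{N}^L)^a_{k\cdot i}g_{aj}-(\mathrm{N}^L)^a_{k\cdot j}g_{ia}$, $\mathrm{Lan}_i=g^{ab}\mathrm{Lan}_{abi}$. $\mathrm{N}=\mathrm{N}^L+\mathcal{J}$, $\mathcal{J}\in\mathrm{h}^1\mathcal{T}^1_1(M_A)$, is a solution of the affine equation of $L$ if on $A$ $$\Big\{2\mathrm{Lan}_b+(n+2)\tfrac{y_a}{L}\mathcal{J}^a_b-2\mathrm{C}_a\mathcal{J}^a_b-(\mathcal{J}^a_{b\cdot a}+\mathcal{J}^a_{a\cdot b})\Big\}(\delta^b_iy^j-y^b\delta^j_i)-(\mathcal{J}^j_{i\cdot a}-\mathcal{J}^j_{a\cdot i})y^a=0 .$$ *)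

theory Defs
  imports "HOL-Analysis.Analysis"
begin

section \<open>Smooth functions on open sets\<close>

text \<open>
  The definitions of this section are meant for open \<open>S\<close> and functions between
  finite-dimensional spaces.
\<close>

primrec diff_times_on ::
  "nat \<Rightarrow> 'a::real_normed_vector set \<Rightarrow> ('a \<Rightarrow> 'b::real_normed_vector) \<Rightarrow> bool" where
  "diff_times_on 0 S f \<longleftrightarrow> continuous_on S f"
| "diff_times_on (Suc m) S f \<longleftrightarrow>
     (\<forall>x\<in>S. f differentiable (at x)) \<and>
     (\<forall>v. diff_times_on m S (\<lambda>x. frechet_derivative f (at x) v))"

definition smooth_on ::
  "'a::real_normed_vector set \<Rightarrow> ('a \<Rightarrow> 'b::real_normed_vector) \<Rightarrow> bool" where
  "smooth_on S f \<longleftrightarrow> (\<forall>m. diff_times_on m S f)"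

definition pd :: "'n \<Rightarrow> (real^'n \<Rightarrow> real) \<Rightarrow> real^'n \<Rightarrow> real" where
  "pd i f x = frechet_derivative f (at x) (axis i 1)"

section \<open>Smooth manifolds\<close>

text \<open>
  A chart is a pair of its domain and its coordinate map; only the values of the map on the
  domain matter.  The dimension is the cardinality of the index type \<open>'n\<close>.
\<close>

type_synonym ('p, 'n) chart = "'p set \<times> ('p \<Rightarrow> real^'n)"

definition chart_inv :: "('p, 'n::finite) chart \<Rightarrow> real^'n \<Rightarrow> 'p" where
  "chart_inv c = inv_into (fst c) (snd c)"

definition transition ::
  "('p, 'n::finite) chart \<Rightarrow> ('p, 'n) chart \<Rightarrow> real^'n \<Rightarrow> real^'n" where
  "transition c d = (\<lambda>x. snd d (chart_inv c x))"

text \<open>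
  The atlas is arbitrary, not necessarily maximal: each of the objects below is determined by its
  components in the charts of an atlas, its components in any other compatible chart being forced
  by the transformation law.
\<close>

definition smooth_manifold :: "'p topology \<Rightarrow> ('p, 'n::finite) chart set \<Rightarrow> bool" where
  "smooth_manifold X At \<longleftrightarrow>
     Hausdorff_space X \<and> second_countable X \<and>
     (\<Union>c\<in>At. fst c) = topspace X \<and>
     (\<forall>c\<in>At. openin X (fst c) \<and> open (snd c ` fst c) \<and>
        homeomorphic_map (subtopology X (fst c)) (top_of_set (snd c ` fst c)) (snd c)) \<and>
     (\<forall>c\<in>At. \<forall>d\<in>At. smooth_on (snd c ` (fst c \<inter> fst d)) (transition c d))"

text \<open>
  If \<open>x\<close> and \<open>x'\<close> denote the coordinates of the charts \<open>c\<close> and \<open>d\<close>, then \<open>jac c d k i\<close> is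
  \<open>\<partial>x'\<^sup>k/\<partial>x\<^sup>i\<close> and \<open>hess c d k i j\<close> is \<open>\<partial>\<^sup>2x'\<^sup>k/\<partial>x\<^sup>i\<partial>x\<^sup>j\<close>, both as functions of \<open>x\<close>.
\<close>

definition jac ::
  "('p, 'n::finite) chart \<Rightarrow> ('p, 'n) chart \<Rightarrow> 'n \<Rightarrow> 'n \<Rightarrow> real^'n \<Rightarrow> real" where
  "jac c d k i x = pd i (\<lambda>u. transition c d u $ k) x"

definition hess ::
  "('p, 'n::finite) chart \<Rightarrow> ('p, 'n) chart \<Rightarrow> 'n \<Rightarrow> 'n \<Rightarrow> 'n \<Rightarrow> real^'n \<Rightarrow> real" where
  "hess c d k i j x = pd i (jac c d k j) x"

section \<open>The tangent bundle and conic domains\<close>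

text \<open>
  A tangent vector at \<open>p\<close> is the family of its coordinate vectors in all charts around \<open>p\<close>, related
  by the Jacobians of the chart changes; its entries at irrelevant charts are set to \<open>0\<close>.
\<close>

type_synonym ('p, 'n) tvec = "'p \<times> (('p, 'n) chart \<Rightarrow> real^'n)"

definition tangent_space ::
  "('p, 'n::finite) chart set \<Rightarrow> 'p \<Rightarrow> (('p, 'n) chart \<Rightarrow> real^'n) set" where
  "tangent_space At p =
     {v. (\<forall>c\<in>At. \<forall>d\<in>At. p \<in> fst c \<inter> fst d \<longrightarrow>
            (\<forall>k. v d $ k = (\<Sum>i\<in>UNIV. jac c d k i (snd c p) * v c $ i))) \<and>
         (\<forall>c. \<not> (c \<in> At \<and> p \<in> fst c) \<longrightarrow> v c = 0)}"

definition tangent_bundle ::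
  "'p topology \<Rightarrow> ('p, 'n::finite) chart set \<Rightarrow> ('p, 'n) tvec set" where
  "tangent_bundle X At = (SIGMA p:topspace X. tangent_space At p)"

definition zero_section :: "'p topology \<Rightarrow> ('p, 'n::finite) tvec set" where
  "zero_section X = {(p, \<lambda>_. 0) | p. p \<in> topspace X}"

definition tscale :: "real \<Rightarrow> ('p, 'n::finite) tvec \<Rightarrow> ('p, 'n) tvec" where
  "tscale t w = (fst w, \<lambda>c. t *\<^sub>R snd w c)"

text \<open>The induced chart \<open>(x\<^sup>i, y\<^sup>i)\<close> of the tangent bundle.\<close>

definition tchart :: "('p, 'n::finite) chart \<Rightarrow> ('p, 'n) tvec \<Rightarrow> (real^'n) \<times> (real^'n)" where
  "tchart c w = (snd c (fst w), snd w c)"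

definition over :: "('p, 'n::finite) tvec set \<Rightarrow> ('p, 'n) chart \<Rightarrow> ('p, 'n) tvec set" where
  "over A c = {w\<in>A. fst w \<in> fst c}"

definition coords ::
  "('p, 'n::finite) tvec set \<Rightarrow> ('p, 'n) chart \<Rightarrow> ((real^'n) \<times> (real^'n)) set" where
  "coords A c = tchart c ` over A c"

text \<open>
  The third clause is openness of \<open>A\<close> in the topology of the tangent bundle, for which the induced
  charts have open domains and are homeomorphisms onto open sets.
\<close>

definition conic_domain ::
  "'p topology \<Rightarrow> ('p, 'n::finite) chart set \<Rightarrow> ('p, 'n) tvec set \<Rightarrow> bool" where
  "conic_domain X At A \<longleftrightarrow>
     A \<subseteq> tangent_bundle X At - zero_section X \<and>
     fst ` A = topspace X \<and>
     (\<forall>c\<in>At. open (coords A c)) \<and>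
     (\<forall>w\<in>A. \<forall>t>0. tscale t w \<in> A)"

section \<open>Anisotropic tensors and nonlinear connections\<close>

text \<open>
  Tensors and connections are given by their component functions of \<open>(x, y)\<close> in each chart of the
  atlas; the values outside \<open>coords A c\<close> are irrelevant.
  In \<open>T c i k\<close> and \<open>N c i k\<close> the index \<open>i\<close> is the lower one and \<open>k\<close> is the upper one.
\<close>

type_synonym 'n fn = "(real^'n) \<times> (real^'n) \<Rightarrow> real"
type_synonym 'n field11 = "'n \<Rightarrow> 'n \<Rightarrow> 'n fn"

definition positively_homogeneous ::
  "real \<Rightarrow> ((real^'n) \<times> (real^'n)) set \<Rightarrow> 'n::finite fn \<Rightarrow> bool" where
  "positively_homogeneous \<alpha> S F \<longleftrightarrow>
     (\<forall>(x, y)\<in>S. \<forall>t>0. F (x, t *\<^sub>R y) = t powr \<alpha> * F (x, y))"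

definition tensor01 ::
  "('p, 'n::finite) chart set \<Rightarrow> ('p, 'n) tvec set \<Rightarrow> (('p, 'n) chart \<Rightarrow> 'n \<Rightarrow> 'n fn) \<Rightarrow> bool" where
  "tensor01 At A T \<longleftrightarrow>
     (\<forall>c\<in>At. \<forall>i. smooth_on (coords A c) (T c i)) \<and>
     (\<forall>c\<in>At. \<forall>d\<in>At. \<forall>w \<in> over A c \<inter> over A d. \<forall>i.
        T d i (tchart d w) =
          (\<Sum>a\<in>UNIV. jac d c a i (snd d (fst w)) * T c a (tchart c w)))"

definition tensor11 ::
  "('p, 'n::finite) chart set \<Rightarrow> ('p, 'n) tvec set \<Rightarrow> (('p, 'n) chart \<Rightarrow> 'n field11) \<Rightarrow> bool" where
  "tensor11 At A T \<longleftrightarrow>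
     (\<forall>c\<in>At. \<forall>i k. smooth_on (coords A c) (T c i k)) \<and>
     (\<forall>c\<in>At. \<forall>d\<in>At. \<forall>w \<in> over A c \<inter> over A d. \<forall>i k.
        T d i k (tchart d w) =
          (\<Sum>m\<in>UNIV. \<Sum>a\<in>UNIV. jac c d k m (snd c (fst w)) * jac d c a i (snd d (fst w))
             * T c a m (tchart c w)))"

definition homogeneous_tensor11 ::
  "real \<Rightarrow> ('p, 'n::finite) chart set \<Rightarrow> ('p, 'n) tvec set \<Rightarrow>
   (('p, 'n) chart \<Rightarrow> 'n field11) \<Rightarrow> bool" where
  "homogeneous_tensor11 \<alpha> At A T \<longleftrightarrow>
     tensor11 At A T \<and> (\<forall>c\<in>At. \<forall>i k. positively_homogeneous \<alpha> (coords A c) (T c i k))"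

definition isotropic ::
  "('p, 'n::finite) chart set \<Rightarrow> ('p, 'n) tvec set \<Rightarrow>
   (('p, 'n) chart \<Rightarrow> (real^'n) \<times> (real^'n) \<Rightarrow> 'b) \<Rightarrow> bool" where
  "isotropic At A T \<longleftrightarrow>
     (\<forall>c\<in>At. \<forall>x y y'. (x, y) \<in> coords A c \<longrightarrow> (x, y') \<in> coords A c \<longrightarrow>
        T c (x, y) = T c (x, y'))"

definition isotropic_one_form ::
  "('p, 'n::finite) chart set \<Rightarrow> ('p, 'n) tvec set \<Rightarrow> (('p, 'n) chart \<Rightarrow> 'n \<Rightarrow> 'n fn) \<Rightarrow> bool" where
  "isotropic_one_form At A T \<longleftrightarrow>
     tensor01 At A T \<and> isotropic At A (\<lambda>c z i. T c i z)"

definition nonlinear_connection ::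
  "('p, 'n::finite) chart set \<Rightarrow> ('p, 'n) tvec set \<Rightarrow> (('p, 'n) chart \<Rightarrow> 'n field11) \<Rightarrow> bool" where
  "nonlinear_connection At A N \<longleftrightarrow>
     (\<forall>c\<in>At. \<forall>i k. smooth_on (coords A c) (N c i k) \<and>
        positively_homogeneous 1 (coords A c) (N c i k)) \<and>
     (\<forall>c\<in>At. \<forall>d\<in>At. \<forall>w \<in> over A c \<inter> over A d. \<forall>i k.
        N d i k (tchart d w) =
          (\<Sum>m\<in>UNIV. \<Sum>b\<in>UNIV. jac c d k m (snd c (fst w))
             * hess d c m i b (snd d (fst w)) * snd w d $ b) +
          (\<Sum>m\<in>UNIV. \<Sum>a\<in>UNIV. jac c d k m (snd c (fst w)) * jac d c a i (snd d (fst w))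
             * N c a m (tchart c w)))"

definition linear_connection ::
  "('p, 'n::finite) chart set \<Rightarrow> ('p, 'n) tvec set \<Rightarrow> (('p, 'n) chart \<Rightarrow> 'n field11) \<Rightarrow> bool" where
  "linear_connection At A N \<longleftrightarrow>
     (\<forall>c\<in>At. \<exists>\<Gamma> :: 'n \<Rightarrow> 'n \<Rightarrow> 'n \<Rightarrow> real^'n \<Rightarrow> real. \<forall>(x, y) \<in> coords A c. \<forall>i k.
        N c i k (x, y) = (\<Sum>a\<in>UNIV. \<Gamma> k i a x * y $ a))"

text \<open>Equality on \<open>A\<close> of two fields given by components.\<close>

definition agree ::
  "('p, 'n::finite) chart set \<Rightarrow> ('p, 'n) tvec set \<Rightarrow>
   (('p, 'n) chart \<Rightarrow> 'n field11) \<Rightarrow> (('p, 'n) chart \<Rightarrow> 'n field11) \<Rightarrow> bool" where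
  "agree At A N N' \<longleftrightarrow> (\<forall>c\<in>At. \<forall>z \<in> coords A c. \<forall>i k. N c i k z = N' c i k z)"

definition tensor_Liouville ::
  "(('p, 'n::finite) chart \<Rightarrow> 'n \<Rightarrow> 'n fn) \<Rightarrow> ('p, 'n) chart \<Rightarrow> 'n field11" where
  "tensor_Liouville \<A> c i k z = \<A> c i z * snd z $ k"

section \<open>Local expressions\<close>

text \<open>
  The following are expressions in one chart \<open>(x, y)\<close>; \<open>F\<close> and \<open>L\<close> are functions and \<open>N\<close> is a
  nonlinear connection in these coordinates.
\<close>

definition dx :: "'n::finite \<Rightarrow> 'n fn \<Rightarrow> 'n fn" where
  "dx i F z = frechet_derivative F (at z) (axis i 1, 0)"

definition dy :: "'n::finite \<Rightarrow> 'n fn \<Rightarrow> 'n fn" where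
  "dy i F z = frechet_derivative F (at z) (0, axis i 1)"

definition delta :: "'n::finite field11 \<Rightarrow> 'n \<Rightarrow> 'n fn \<Rightarrow> 'n fn" where
  "delta N i F z = dx i F z - (\<Sum>a\<in>UNIV. N i a z * dy a F z)"

definition curvature :: "'n::finite field11 \<Rightarrow> 'n \<Rightarrow> 'n \<Rightarrow> 'n \<Rightarrow> 'n fn" where
  "curvature N i j k z = delta N j (N i k) z - delta N i (N j k) z"

definition Ric :: "'n::finite field11 \<Rightarrow> 'n fn" where
  "Ric N z = (\<Sum>a\<in>UNIV. \<Sum>b\<in>UNIV. snd z $ b * curvature N b a a z)"

definition g_matrix :: "'n::finite fn \<Rightarrow> (real^'n) \<times> (real^'n) \<Rightarrow> real^'n^'n" where
  "g_matrix L z = (\<chi> i j. 1 / 2 * dy j (dy i L) z)"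

definition g_low :: "'n::finite fn \<Rightarrow> 'n \<Rightarrow> 'n \<Rightarrow> 'n fn" where
  "g_low L i j z = g_matrix L z $ i $ j"

definition g_inv :: "'n::finite fn \<Rightarrow> 'n \<Rightarrow> 'n \<Rightarrow> 'n fn" where
  "g_inv L i j z = matrix_inv (g_matrix L z) $ i $ j"

definition y_low :: "'n::finite fn \<Rightarrow> 'n \<Rightarrow> 'n fn" where
  "y_low L i z = (\<Sum>a\<in>UNIV. g_low L i a z * snd z $ a)"

definition spray :: "'n::finite fn \<Rightarrow> 'n \<Rightarrow> 'n fn" where
  "spray L i z = 1 / 4 * (\<Sum>a\<in>UNIV. \<Sum>b\<in>UNIV. \<Sum>m\<in>UNIV.
     g_inv L i a z * (2 * dx m (g_low L a b) z - dx a (g_low L b m) z) * snd z $ b * snd z $ m)"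

definition canonical_conn :: "'n::finite fn \<Rightarrow> 'n field11" where
  "canonical_conn L i k z = dy i (spray L k) z"

definition mean_Cartan :: "'n::finite fn \<Rightarrow> 'n \<Rightarrow> 'n fn" where
  "mean_Cartan L i z = (\<Sum>a\<in>UNIV. \<Sum>b\<in>UNIV. g_inv L a b z * (1 / 2 * dy i (g_low L a b) z))"

definition nabla_g :: "'n::finite fn \<Rightarrow> 'n \<Rightarrow> 'n \<Rightarrow> 'n \<Rightarrow> 'n fn" where
  "nabla_g L k i j z = delta (canonical_conn L) k (g_low L i j) z
     - (\<Sum>a\<in>UNIV. dy i (canonical_conn L k a) z * g_low L a j z)
     - (\<Sum>a\<in>UNIV. dy j (canonical_conn L k a) z * g_low L i a z)"

definition mean_Landsberg :: "'n::finite fn \<Rightarrow> 'n \<Rightarrow> 'n fn" where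
  "mean_Landsberg L i z =
     (\<Sum>a\<in>UNIV. \<Sum>b\<in>UNIV. g_inv L a b z * (1 / 2 * nabla_g L i a b z))"

definition kronecker :: "'n \<Rightarrow> 'n \<Rightarrow> real" where
  "kronecker i j = (if i = j then 1 else 0)"

text \<open>Left-hand side of the affine equation of \<open>L\<close>, with free indices \<open>i\<close> (lower), \<open>j\<close> (upper).\<close>

definition affine_expr :: "'n::finite fn \<Rightarrow> 'n field11 \<Rightarrow> 'n field11" where
  "affine_expr L J i j z =
     (\<Sum>b\<in>UNIV.
        (2 * mean_Landsberg L b z
         + real (CARD('n) + 2) * (\<Sum>a\<in>UNIV. y_low L a z / L z * J b a z)
         - 2 * (\<Sum>a\<in>UNIV. mean_Cartan L a z * J b a z)
         - (\<Sum>a\<in>UNIV. dy a (J b a) z + dy b (J a a) z))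
        * (kronecker b i * snd z $ j - snd z $ b * kronecker j i))
     - (\<Sum>a\<in>UNIV. (dy a (J i j) z - dy i (J a j) z) * snd z $ a)"

definition metric_expr :: "'n::finite fn \<Rightarrow> 'n field11 \<Rightarrow> 'n fn" where
  "metric_expr L N z =
     real (CARD('n) + 2) * Ric N z
     - L z * (\<Sum>a\<in>UNIV. \<Sum>b\<in>UNIV. g_inv L a b z * dy b (dy a (Ric N)) z)"

section \<open>Pseudo-Finsler metrics and the field equations\<close>

definition local_rep ::
  "('p, 'n::finite) tvec set \<Rightarrow> (('p, 'n) tvec \<Rightarrow> real) \<Rightarrow> ('p, 'n) chart \<Rightarrow> 'n fn" where
  "local_rep A L c z = L (inv_into (over A c) (tchart c) z)"

definition pseudo_Finsler ::
  "('p, 'n::finite) chart set \<Rightarrow> ('p, 'n) tvec set \<Rightarrow> (('p, 'n) tvec \<Rightarrow> real) \<Rightarrow> bool" where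
  "pseudo_Finsler At A L \<longleftrightarrow>
     (\<forall>c\<in>At. smooth_on (coords A c) (local_rep A L c)) \<and>
     (\<forall>w\<in>A. \<forall>t>0. L (tscale t w) = t powr 2 * L w) \<and>
     (\<forall>c\<in>At. \<forall>z \<in> coords A c. invertible (g_matrix (local_rep A L c) z))"

text \<open>\<open>L = g\<^sub>a\<^sub>b(x) y\<^sup>a y\<^sup>b\<close> then follows from Euler's theorem.\<close>

definition pseudo_Riemannian ::
  "('p, 'n::finite) chart set \<Rightarrow> ('p, 'n) tvec set \<Rightarrow> (('p, 'n) tvec \<Rightarrow> real) \<Rightarrow> bool" where
  "pseudo_Riemannian At A L \<longleftrightarrow> isotropic At A (\<lambda>c. g_matrix (local_rep A L c))"

definition conn_of ::
  "('p, 'n::finite) tvec set \<Rightarrow> (('p, 'n) tvec \<Rightarrow> real) \<Rightarrow> ('p, 'n) chart \<Rightarrow> 'n field11" where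
  "conn_of A L c = canonical_conn (local_rep A L c)"

definition solves_affine ::
  "('p, 'n::finite) chart set \<Rightarrow> ('p, 'n) tvec set \<Rightarrow> (('p, 'n) tvec \<Rightarrow> real) \<Rightarrow>
   (('p, 'n) chart \<Rightarrow> 'n field11) \<Rightarrow> bool" where
  "solves_affine At A L N \<longleftrightarrow>
     (\<exists>J. homogeneous_tensor11 1 At A J \<and>
          agree At A N (\<lambda>c i k z. conn_of A L c i k z + J c i k z) \<and>
          (\<forall>c\<in>At. \<forall>z \<in> coords A c. \<forall>i j. affine_expr (local_rep A L c) (J c) i j z = 0))"

definition solves_metric ::
  "('p, 'n::finite) chart set \<Rightarrow> ('p, 'n) tvec set \<Rightarrow> (('p, 'n) tvec \<Rightarrow> real) \<Rightarrow>
   (('p, 'n) chart \<Rightarrow> 'n field11) \<Rightarrow> bool" where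
  "solves_metric At A L N \<longleftrightarrow>
     (\<forall>c\<in>At. \<forall>z \<in> coords A c. metric_expr (local_rep A L c) (N c) z = 0)"

definition same_Ric ::
  "('p, 'n::finite) chart set \<Rightarrow> ('p, 'n) tvec set \<Rightarrow>
   (('p, 'n) chart \<Rightarrow> 'n field11) \<Rightarrow> (('p, 'n) chart \<Rightarrow> 'n field11) \<Rightarrow> bool" where
  "same_Ric At A N N' \<longleftrightarrow> (\<forall>c\<in>At. \<forall>z \<in> coords A c. Ric (N c) z = Ric (N' c) z)"

definition solves_Einstein ::
  "('p, 'n::finite) chart set \<Rightarrow> ('p, 'n) tvec set \<Rightarrow> (('p, 'n) tvec \<Rightarrow> real) \<Rightarrow> bool" where
  "solves_Einstein At A L \<longleftrightarrow> (\<forall>c\<in>At. \<forall>z \<in> coords A c. Ric (conn_of A L c) z = 0)"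

end

theory Submission
  imports Defs
begin

text \<open>
  All objects are given by components, so the proof takes place in a single chart
  (\<open>pseudo_riemannian_chart\<close>); only the transformation law of the resulting \<open>1\<close>-form relates
  different charts.

  When \<open>g\<close> is isotropic, Euler's theorem gives \<open>L = g\<^sub>a\<^sub>b(x) y\<^sup>a y\<^sup>b\<close>, the canonical connection is
  \<open>\<Gamma>\<^sup>k\<^sub>i\<^sub>a(x) y\<^sup>a\<close> with the Levi-Civita symbols (\<open>canonical_conn_eq\<close>), and the mean Cartan and mean
  Landsberg tensors vanish. If \<open>N\<close> is linear, then so is \<open>J = N - N\<^sup>L\<close>, and at each point \<open>x\<close> the affine
  equation becomes an identity between rational functions of \<open>y\<close>, valid for \<open>y\<close> in an open set. Its
  denominator is \<open>L\<close>. For each lower index there are two upper indices different from it, which is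
  where \<open>n \<ge> 3\<close> first enters, and cross-multiplying these two components of the equation eliminates
  the denominator; what remains is linear algebra for a tensor with three indices, similar to the
  uniqueness proof of the Levi-Civita connection, and gives \<open>J\<^sub>i\<^sup>k = \<alpha>\<^sub>i(x) y\<^sup>k\<close> (\<open>liouville_of_affine_equation\<close>). The converse is a direct
  computation (\<open>affine_expr_liouville\<close>).

  Such a change of the connection adds \<open>(\<partial>\<^sub>j\<alpha>\<^sub>i - \<partial>\<^sub>i\<alpha>\<^sub>j) y\<^sup>k\<close> to the curvature, which does not contribute
  to the Ricci scalar (\<open>Ric_add_liouville\<close>). The Ricci scalar of a linear connection is quadratic
  in \<open>y\<close> (\<open>Ric_fibre_quadratic\<close>). The metric equation forces it to be \<open>c(x) L\<close>, and the trace of that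
  relation gives \<open>(n - 2) c = 0\<close> (\<open>ricci_flat_of_metric_equation\<close>). So the metric equation is equivalent
  to \<open>Ric = 0\<close>, that is, to \<open>Ric\<^sup>L = 0\<close>.
\<close>

section \<open>Smooth functions\<close>

lemma differentiable_transform_within_open:
  assumes "f differentiable (at x)" "open S" "x \<in> S" "\<And>x. x \<in> S \<Longrightarrow> f x = g x"
  shows "g differentiable (at x)"
  using assms by (meson differentiable_def has_derivative_transform_within_open)

lemma diff_times_on_cong:
  assumes "open S" and "\<And>x. x \<in> S \<Longrightarrow> f x = g x" and "diff_times_on m S f"
  shows "diff_times_on m S g"
  using assms(2,3)
proof (induction m arbitrary: f g)
  case 0
  then show ?case
    by (simp cong: continuous_on_cong)
next
  case (Suc m)
  have df: "f differentiable (at x)" if "x \<in> S" for x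
    using Suc.prems(2) that by simp
  have "frechet_derivative f (at x) = frechet_derivative g (at x)" if "x \<in> S" for x
    by (rule frechet_derivative_transform_within_open[OF df \<open>open S\<close>])
      (use Suc.prems(1) that in auto)
  then have "diff_times_on m S (\<lambda>x. frechet_derivative g (at x) v)" for v
    using Suc.IH[of "\<lambda>x. frechet_derivative f (at x) v"] Suc.prems(2) by simp
  moreover have "g differentiable (at x)" if "x \<in> S" for x
    using differentiable_transform_within_open[OF df \<open>open S\<close>] Suc.prems(1) that by blast
  ultimately show ?case
    by simp
qed

lemma diff_times_on_mono: "diff_times_on (Suc m) S f \<Longrightarrow> diff_times_on m S f"
proof (induction m arbitrary: f)
  case 0
  then show ?case
    by (simp add: differentiable_imp_continuous_on differentiable_at_imp_differentiable_on)
next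
  case (Suc m)
  then show ?case
    by (metis diff_times_on.simps(2))
qed

lemma diff_times_on_const: "diff_times_on m S (\<lambda>x. c)"
  by (induction m arbitrary: c) auto

lemma diff_times_on_bounded_linear:
  assumes "bounded_linear f"
  shows "diff_times_on m S f"
proof (cases m)
  case 0
  then show ?thesis
    using assms by (simp add: linear_continuous_on)
next
  case (Suc k)
  have "frechet_derivative f (at x) = f" for x
    using frechet_derivative_at[OF bounded_linear_imp_has_derivative[OF assms]] by metis
  then show ?thesis
    using Suc assms by (auto simp: diff_times_on_const intro: bounded_linear_imp_differentiable)
qed

lemma diff_times_on_add:
  assumes "open S" and "diff_times_on m S f" and "diff_times_on m S g"
  shows "diff_times_on m S (\<lambda>x. f x + g x)"
  using assms(2,3)
proof (induction m arbitrary: f g)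
  case 0
  then show ?case
    by (simp add: continuous_on_add)
next
  case (Suc m)
  have d: "f differentiable (at x)" "g differentiable (at x)" if "x \<in> S" for x
    using Suc.prems that by auto
  have "frechet_derivative f (at x) v + frechet_derivative g (at x) v
      = frechet_derivative (\<lambda>x. f x + g x) (at x) v" if "x \<in> S" for x v
    using frechet_derivative_at[OF has_derivative_add[OF
        d(1)[OF that, unfolded frechet_derivative_works]
        d(2)[OF that, unfolded frechet_derivative_works]]] by metis
  then have "diff_times_on m S (\<lambda>x. frechet_derivative (\<lambda>x. f x + g x) (at x) v)" for v
    by (rule diff_times_on_cong[OF \<open>open S\<close>]) (use Suc in auto)
  then show ?case
    using d by simp
qed

text \<open>
  The Leibniz rule writes the derivative of a product with the undifferentiated factors in it, so
  the induction on the order needs that \<open>m + 1\<close> derivatives entail \<open>m\<close> of them.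
\<close>

lemma diff_times_on_mult:
  fixes f g :: "'a::real_normed_vector \<Rightarrow> real"
  assumes "open S" and "diff_times_on m S f" and "diff_times_on m S g"
  shows "diff_times_on m S (\<lambda>x. f x * g x)"
  using assms(2,3)
proof (induction m arbitrary: f g)
  case 0
  then show ?case
    by (simp add: continuous_on_mult)
next
  case (Suc m)
  have d: "f differentiable (at x)" "g differentiable (at x)" if "x \<in> S" for x
    using Suc.prems that by auto
  have "f x * frechet_derivative g (at x) v + frechet_derivative f (at x) v * g x
      = frechet_derivative (\<lambda>x. f x * g x) (at x) v" if "x \<in> S" for x v
    using frechet_derivative_at[OF has_derivative_mult[OF
        d(1)[OF that, unfolded frechet_derivative_works]
        d(2)[OF that, unfolded frechet_derivative_works]]] by metis
  then have "diff_times_on m S (\<lambda>x. frechet_derivative (\<lambda>x. f x * g x) (at x) v)" for v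
    by (rule diff_times_on_cong[OF \<open>open S\<close>])
      (use Suc diff_times_on_mono[OF Suc.prems(1)] diff_times_on_mono[OF Suc.prems(2)]
       in \<open>auto intro!: diff_times_on_add[OF \<open>open S\<close>]\<close>)
  then show ?case
    using d by simp
qed

lemma smooth_on_const: "smooth_on S (\<lambda>x. c)"
  by (simp add: smooth_on_def diff_times_on_const)

lemma smooth_on_add: "open S \<Longrightarrow> smooth_on S f \<Longrightarrow> smooth_on S g \<Longrightarrow> smooth_on S (\<lambda>x. f x + g x)"
  by (simp add: smooth_on_def diff_times_on_add)

lemma smooth_on_mult:
  fixes f g :: "'a::real_normed_vector \<Rightarrow> real"
  shows "open S \<Longrightarrow> smooth_on S f \<Longrightarrow> smooth_on S g \<Longrightarrow> smooth_on S (\<lambda>x. f x * g x)"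
  by (simp add: smooth_on_def diff_times_on_mult)

lemma smooth_on_diff:
  fixes f g :: "'a::real_normed_vector \<Rightarrow> real"
  assumes "open S" "smooth_on S f" "smooth_on S g"
  shows "smooth_on S (\<lambda>x. f x - g x)"
  using smooth_on_add[OF assms(1,2) smooth_on_mult[OF assms(1) smooth_on_const[of S "-1"] assms(3)]]
  by simp

lemma smooth_on_sum:
  assumes "open S" "\<And>i. i \<in> I \<Longrightarrow> smooth_on S (f i)"
  shows "smooth_on S (\<lambda>x. \<Sum>i\<in>I. f i x)"
  using assms(2)
  by (induction I rule: infinite_finite_induct)
    (auto intro!: smooth_on_const smooth_on_add[OF assms(1)])

lemma smooth_on_snd_nth: "smooth_on S (\<lambda>z. snd z $ k)"
  unfolding smooth_on_def
  by (auto intro!: diff_times_on_bounded_linear bounded_linear_compose[OF bounded_linear_vec_nth]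
      bounded_linear_snd)

lemma smooth_on_differentiable: "smooth_on S f \<Longrightarrow> x \<in> S \<Longrightarrow> f differentiable (at x)"
  unfolding smooth_on_def by (metis diff_times_on.simps(2))

lemma smooth_on_frechet_derivative:
  "smooth_on S f \<Longrightarrow> smooth_on S (\<lambda>x. frechet_derivative f (at x) v)"
  unfolding smooth_on_def by (metis diff_times_on.simps(2))

lemma smooth_on_dx: "smooth_on S F \<Longrightarrow> smooth_on S (dx i F)"
  using smooth_on_frechet_derivative[of S F "(axis i 1, 0)"] by (simp add: dx_def[abs_def])

lemma smooth_on_dy: "smooth_on S F \<Longrightarrow> smooth_on S (dy i F)"
  using smooth_on_frechet_derivative[of S F "(0, axis i 1)"] by (simp add: dy_def[abs_def])

section \<open>Partial derivatives on the tangent bundle\<close>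

lemma dx_eqI: "(F has_derivative F') (at z) \<Longrightarrow> dx i F z = F' (axis i 1, 0)"
  unfolding dx_def by (metis frechet_derivative_at)

lemma dy_eqI: "(F has_derivative F') (at z) \<Longrightarrow> dy i F z = F' (0, axis i 1)"
  unfolding dy_def by (metis frechet_derivative_at)

lemma has_derivative_frechet:
  "F differentiable (at z) \<Longrightarrow> (F has_derivative frechet_derivative F (at z)) (at z)"
  by (simp add: frechet_derivative_works)

lemma differentiable_snd_nth [simp]: "(\<lambda>z. snd z $ k) differentiable (at (z :: 'a::real_normed_vector \<times> (real^'n)))"
  using smooth_on_differentiable[OF smooth_on_snd_nth] by blast

lemma
  assumes "F differentiable (at z)" "G differentiable (at z)"
  shows dx_add: "dx i (\<lambda>z. F z + G z) z = dx i F z + dx i G z"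
    and dy_add: "dy i (\<lambda>z. F z + G z) z = dy i F z + dy i G z"
    and dx_mult: "dx i (\<lambda>z. F z * G z) z = F z * dx i G z + dx i F z * G z"
    and dy_mult: "dy i (\<lambda>z. F z * G z) z = F z * dy i G z + dy i F z * G z"
proof -
  note d = assms[THEN has_derivative_frechet]
  note r = has_derivative_add[OF d] has_derivative_mult[OF d]
  show "dx i (\<lambda>z. F z + G z) z = dx i F z + dx i G z" "dy i (\<lambda>z. F z + G z) z = dy i F z + dy i G z"
    "dx i (\<lambda>z. F z * G z) z = F z * dx i G z + dx i F z * G z"
    "dy i (\<lambda>z. F z * G z) z = F z * dy i G z + dy i F z * G z"
    by (simp_all only: r[THEN dx_eqI] r[THEN dy_eqI], simp_all only: dx_def dy_def)
qed

lemma dx_sum: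
  assumes "\<And>a. a \<in> I \<Longrightarrow> F a differentiable (at z)"
  shows "dx i (\<lambda>z. \<Sum>a\<in>I. F a z) z = (\<Sum>a\<in>I. dx i (F a) z)"
proof -
  have "((\<lambda>z. \<Sum>a\<in>I. F a z) has_derivative (\<lambda>v. \<Sum>a\<in>I. frechet_derivative (F a) (at z) v)) (at z)"
    using assms by (intro has_derivative_sum has_derivative_frechet)
  then show ?thesis
    by (simp add: dx_eqI, simp add: dx_def)
qed

lemma dy_const [simp]: "dy i (\<lambda>z. c) z = 0"
  by (simp add: dy_def)

lemma dx_snd_nth [simp]: "dx i (\<lambda>z. snd z $ k) z = 0"
  and dy_snd_nth [simp]: "dy i (\<lambda>z. snd z $ k) z = kronecker i k"
proof -
  have "((\<lambda>z. snd z $ k) has_derivative (\<lambda>v. snd v $ k)) (at z)"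
    by (intro bounded_linear_imp_has_derivative bounded_linear_compose[OF bounded_linear_vec_nth]
        bounded_linear_snd)
  then show "dx i (\<lambda>z. snd z $ k) z = 0" and "dy i (\<lambda>z. snd z $ k) z = kronecker i k"
    by (simp_all add: dx_eqI dy_eqI kronecker_def axis_def)
qed

lemma
  assumes "open U" "z \<in> U" "F differentiable (at z)" "\<And>w. w \<in> U \<Longrightarrow> F w = G w"
  shows dx_cong: "dx i F z = dx i G z" and dy_cong: "dy i F z = dy i G z"
  unfolding dx_def dy_def
  using frechet_derivative_transform_within_open[OF assms(3,1,2,4)] by metis+

lemma sum_kronecker [simp]:
  fixes f :: "'n::finite \<Rightarrow> real"
  shows "(\<Sum>a\<in>UNIV. kronecker a i * f a) = f i" "(\<Sum>a\<in>UNIV. kronecker i a * f a) = f i"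
    "(\<Sum>a\<in>UNIV. f a * kronecker a i) = f i" "(\<Sum>a\<in>UNIV. f a * kronecker i a) = f i"
    "(\<Sum>a\<in>UNIV. kronecker a i) = 1" "(\<Sum>a\<in>UNIV. kronecker i a) = 1"
  unfolding kronecker_def by (simp_all add: if_distrib[of "\<lambda>x. x * _"] if_distrib[of "\<lambda>x. _ * x"] cong: if_cong)

section \<open>Restriction to a fibre\<close>

lemma has_derivative_fibre:
  assumes "F differentiable (at (x, y))"
  shows "((\<lambda>y. F (x, y)) has_derivative (\<lambda>v. frechet_derivative F (at (x, y)) (0, v))) (at y)"
proof -
  have "((\<lambda>y. (x, y)) has_derivative (\<lambda>v. (0, v))) (at y)"
    by (auto intro!: derivative_eq_intros)
  from has_derivative_compose[OF this has_derivative_frechet[OF assms]] show ?thesis .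
qed

lemma has_derivative_base:
  assumes "F differentiable (at (x, y))"
  shows "((\<lambda>x. F (x, y)) has_derivative (\<lambda>v. frechet_derivative F (at (x, y)) (v, 0))) (at x)"
proof -
  have "((\<lambda>x. (x, y)) has_derivative (\<lambda>v. (v, 0))) (at x)"
    by (auto intro!: derivative_eq_intros)
  from has_derivative_compose[OF this has_derivative_frechet[OF assms]] show ?thesis .
qed

lemma open_fibre:
  fixes U :: "('a::topological_space \<times> 'b::topological_space) set"
  assumes "open U" shows "open {y. (x, y) \<in> U}"
proof -
  have "continuous_on UNIV (\<lambda>y. (x, y))"
    by (intro continuous_intros)
  from open_vimage[OF assms this] show ?thesis
    by (simp add: vimage_def)
qed

lemma open_slice:
  fixes U :: "('a::topological_space \<times> 'b::topological_space) set"
  assumes "open U" shows "open {x. (x, y) \<in> U}"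
proof -
  have "continuous_on UNIV (\<lambda>x. (x, y))"
    by (intro continuous_intros)
  from open_vimage[OF assms this] show ?thesis
    by (simp add: vimage_def)
qed

lemma sum_axis_real: "(\<Sum>a\<in>UNIV. y $ a *\<^sub>R axis a 1) = (y :: real^'n)"
  by (simp add: vec_eq_iff axis_def if_distrib[of "\<lambda>x. _ * x"] cong: if_cong)

text \<open>Expresses Euler's operator \<open>y\<^sup>a \<partial>/\<partial>y\<^sup>a\<close> as a directional derivative.\<close>

lemma dy_sum_snd:
  assumes "F differentiable (at z)"
  shows "(\<Sum>a\<in>UNIV. dy a F z * v $ a) = frechet_derivative F (at z) (0, v)"
proof -
  have lin: "linear (\<lambda>v. frechet_derivative F (at z) (0, v))"
    using linear_compose[of "\<lambda>v. (0, v)", OF _ linear_frechet_derivative[OF assms]]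
    by (simp add: o_def linear_iff)
  have "frechet_derivative F (at z) (0, v) = frechet_derivative F (at z) (0, \<Sum>a\<in>UNIV. v $ a *\<^sub>R axis a 1)"
    by (simp only: sum_axis_real)
  also have "\<dots> = (\<Sum>a\<in>UNIV. v $ a * frechet_derivative F (at z) (0, axis a 1))"
    by (simp only: linear_sum[OF lin] linear_cmul[OF lin] real_scaleR_def)
  finally show ?thesis
    by (simp add: dy_def mult.commute)
qed

text \<open>
  A vertical derivative only sees the fibre, where most fields below are polynomials in \<open>y\<close> with
  constant coefficients \<open>h\<close> although nothing is known about these coefficients as functions of \<open>x\<close>.
  Differentiability of \<open>F\<close> in all variables is what makes \<open>frechet_derivative\<close> meaningful.
\<close>

lemma dy_eq_fibreI:
  assumes "open U" "(x, y) \<in> U" "F differentiable (at (x, y))"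
    and "\<And>y'. (x, y') \<in> U \<Longrightarrow> F (x, y') = h y'" and "(h has_derivative h') (at y)"
  shows "dy i F (x, y) = h' (axis i 1)"
proof -
  have "(h has_derivative (\<lambda>v. frechet_derivative F (at (x, y)) (0, v))) (at y)"
    using has_derivative_transform_within_open[OF has_derivative_fibre[OF assms(3)] open_fibre[OF assms(1)]]
      assms(2,4) by simp
  then have "h' = (\<lambda>v. frechet_derivative F (at (x, y)) (0, v))"
    using assms(5) has_derivative_unique by blast
  then show ?thesis
    by (simp add: dy_def)
qed

definition isotropic_on :: "((real^'n) \<times> (real^'n)) set \<Rightarrow> 'n fn \<Rightarrow> bool" where
  "isotropic_on U F \<longleftrightarrow> (\<forall>x y y'. (x, y) \<in> U \<longrightarrow> (x, y') \<in> U \<longrightarrow> F (x, y) = F (x, y'))"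

lemma isotropic_onI:
  assumes "\<And>x y y'. (x, y) \<in> U \<Longrightarrow> (x, y') \<in> U \<Longrightarrow> F (x, y) = F (x, y')"
  shows "isotropic_on U F"
  using assms unfolding isotropic_on_def by blast

lemma isotropic_onD: "isotropic_on U F \<Longrightarrow> (x, y) \<in> U \<Longrightarrow> (x, y') \<in> U \<Longrightarrow> F (x, y) = F (x, y')"
  unfolding isotropic_on_def by blast

lemma dy_isotropic:
  assumes "open U" "z \<in> U" "F differentiable (at z)" "isotropic_on U F"
  shows "dy i F z = 0"
proof -
  obtain x y where z: "z = (x, y)" by (cases z)
  show ?thesis
    unfolding z
  proof (rule dy_eq_fibreI[OF assms(1), of x y F "\<lambda>_. F (x, y)" "\<lambda>_. 0"])
    show "F (x, y') = F (x, y)" if "(x, y') \<in> U" for y'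
      using isotropic_onD[OF assms(4) that] assms(2) z by blast
  qed (use assms(2,3) z in \<open>simp_all only: has_derivative_const\<close>)
qed

text \<open>
  A fibre of \<open>U\<close> need not be connected, so isotropy is not a consequence of vanishing vertical
  derivatives. It is compared here on the set of all base points whose fibre contains both \<open>y\<close> and
  \<open>y'\<close>; this set is open, which is enough to differentiate along the base.
\<close>

lemma dx_isotropic:
  assumes "open U" "\<And>z. z \<in> U \<Longrightarrow> F differentiable (at z)" "isotropic_on U F"
  shows "isotropic_on U (dx i F)"
  unfolding isotropic_on_def
proof (intro allI impI)
  fix x y y' assume *: "(x, y) \<in> U" "(x, y') \<in> U"
  let ?V = "{x. (x, y) \<in> U} \<inter> {x. (x, y') \<in> U}"
  have "((\<lambda>x. F (x, y')) has_derivative (\<lambda>v. frechet_derivative F (at (x, y)) (v, 0))) (at x)"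
  proof (rule has_derivative_transform_within_open[where s = ?V, OF has_derivative_base])
    show "F (u, y) = F (u, y')" if "u \<in> ?V" for u
      using isotropic_onD[OF assms(3)] that by blast
  qed (use * assms(2) in \<open>auto intro: open_slice[OF assms(1)]\<close>)
  moreover have "((\<lambda>x. F (x, y')) has_derivative (\<lambda>v. frechet_derivative F (at (x, y')) (v, 0))) (at x)"
    using has_derivative_base[OF assms(2)[OF *(2)]] .
  ultimately have "(\<lambda>v. frechet_derivative F (at (x, y)) (v, 0)) = (\<lambda>v. frechet_derivative F (at (x, y')) (v, 0))"
    by (rule has_derivative_unique)
  then show "dx i F (x, y) = dx i F (x, y')"
    by (auto simp: dx_def fun_eq_iff)
qed

text \<open>Both sides are the derivative at \<open>t = 1\<close> of \<open>F\<close> along the ray \<open>t \<mapsto> (x, t y)\<close>.\<close>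

lemma euler_identity:
  assumes "F differentiable (at (x, y))" and "\<And>t. t > 0 \<Longrightarrow> F (x, t *\<^sub>R y) = t ^ k * F (x, y)"
  shows "(\<Sum>a\<in>UNIV. dy a F (x, y) * y $ a) = real k * F (x, y)"
proof -
  have "((\<lambda>t. F (x, t *\<^sub>R y)) has_derivative (\<lambda>s. frechet_derivative F (at (x, y)) (0, s *\<^sub>R y))) (at 1)"
  proof (rule has_derivative_compose[where g = "\<lambda>y. F (x, y)"])
    show "((\<lambda>t. t *\<^sub>R y) has_derivative (\<lambda>s. s *\<^sub>R y)) (at 1)"
      by (auto intro!: derivative_eq_intros)
  qed (simp add: has_derivative_fibre[OF assms(1)])
  then have 1: "((\<lambda>t. t ^ k * F (x, y)) has_derivative (\<lambda>s. frechet_derivative F (at (x, y)) (0, s *\<^sub>R y))) (at 1)"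
    by (rule has_derivative_transform_within_open[where s = "{0<..}"]) (auto simp: assms(2))
  have 2: "((\<lambda>t. t ^ k * F (x, y)) has_derivative (\<lambda>s. s * (real k * F (x, y)))) (at 1)"
    by (auto intro!: derivative_eq_intros)
  have "frechet_derivative F (at (x, y)) (0, y) = real k * F (x, y)"
    using fun_cong[OF has_derivative_unique[OF 1 2], of 1] by simp
  then show ?thesis
    by (simp add: dy_sum_snd[OF assms(1)])
qed

lemma dy_homogeneous:
  assumes "open U" and "\<And>x y t. (x, y) \<in> U \<Longrightarrow> t > 0 \<Longrightarrow> (x, t *\<^sub>R y) \<in> U"
    and "\<And>z. z \<in> U \<Longrightarrow> F differentiable (at z)"
    and "\<And>x y t. (x, y) \<in> U \<Longrightarrow> t > 0 \<Longrightarrow> F (x, t *\<^sub>R y) = t ^ Suc k * F (x, y)"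
    and "(x, y) \<in> U" "t > 0"
  shows "dy i F (x, t *\<^sub>R y) = t ^ k * dy i F (x, y)"
proof -
  have "((\<lambda>y. F (x, t *\<^sub>R y)) has_derivative (\<lambda>v. frechet_derivative F (at (x, t *\<^sub>R y)) (0, t *\<^sub>R v))) (at y)"
  proof (rule has_derivative_compose[where g = "\<lambda>y. F (x, y)"])
    show "((\<lambda>y. t *\<^sub>R y) has_derivative (\<lambda>v. t *\<^sub>R v)) (at y)"
      by (auto intro!: derivative_eq_intros)
  qed (rule has_derivative_fibre[OF assms(3)[OF assms(2)[OF assms(5,6)]]])
  then have 1: "((\<lambda>y. t ^ Suc k * F (x, y)) has_derivative (\<lambda>v. frechet_derivative F (at (x, t *\<^sub>R y)) (0, t *\<^sub>R v))) (at y)"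
    by (rule has_derivative_transform_within_open[OF _ open_fibre[OF assms(1), of x]]) (use assms in auto)
  have 2: "((\<lambda>y. t ^ Suc k * F (x, y)) has_derivative (\<lambda>v. t ^ Suc k * frechet_derivative F (at (x, y)) (0, v))) (at y)"
    using has_derivative_mult_right[OF has_derivative_fibre[OF assms(3)[OF assms(5)]]] .
  have lin: "linear (frechet_derivative F (at (x, t *\<^sub>R y)))"
    using assms by (intro linear_frechet_derivative) auto
  have "t * dy i F (x, t *\<^sub>R y) = t * (t ^ k * dy i F (x, y))"
    using fun_cong[OF has_derivative_unique[OF 1 2], of "axis i 1"] linear_cmul[OF lin, of t "(0, axis i 1)"]
    unfolding dy_def by (simp only: scaleR_Pair scaleR_zero_right real_scaleR_def power_Suc mult.assoc)
  then show ?thesis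
    using assms(6) by simp
qed

section \<open>Linear and quadratic forms on open sets\<close>

lemma has_derivative_vec_nth: "((\<lambda>y :: real^'n. y $ a) has_derivative (\<lambda>v. v $ a)) (at y)"
  by (rule bounded_linear_imp_has_derivative[OF bounded_linear_vec_nth])

lemma has_derivative_linear_form:
  "((\<lambda>y :: real^'n. \<Sum>a\<in>UNIV. p a * y $ a) has_derivative (\<lambda>v. \<Sum>a\<in>UNIV. p a * v $ a)) (at y)"
  by (intro has_derivative_sum has_derivative_mult_right has_derivative_vec_nth)

lemma has_derivative_quadratic_form:
  "((\<lambda>y :: real^'n. \<Sum>a\<in>UNIV. \<Sum>b\<in>UNIV. M a b * y $ a * y $ b)
     has_derivative (\<lambda>v. \<Sum>a\<in>UNIV. (\<Sum>b\<in>UNIV. (M a b + M b a) * y $ b) * v $ a)) (at y)"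
proof -
  have "((\<lambda>y :: real^'n. \<Sum>a\<in>UNIV. \<Sum>b\<in>UNIV. M a b * y $ a * y $ b)
     has_derivative (\<lambda>v. \<Sum>a\<in>UNIV. \<Sum>b\<in>UNIV. M a b * y $ a * v $ b + M a b * v $ a * y $ b)) (at y)"
    by (intro has_derivative_sum has_derivative_mult has_derivative_mult_right has_derivative_vec_nth)
  moreover have "(\<Sum>a\<in>UNIV. \<Sum>b\<in>UNIV. M a b * y $ a * v $ b + M a b * v $ a * y $ b)
     = (\<Sum>a\<in>UNIV. (\<Sum>b\<in>UNIV. (M a b + M b a) * y $ b) * v $ a)" for v :: "real^'n"
  proof -
    have "(\<Sum>a\<in>UNIV. \<Sum>b\<in>UNIV. M a b * y $ a * v $ b) = (\<Sum>a\<in>UNIV. \<Sum>b\<in>UNIV. M b a * y $ b * v $ a)"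
      by (rule sum.swap)
    then show ?thesis
      by (simp add: sum.distrib sum_distrib_right sum_distrib_left algebra_simps)
  qed
  ultimately show ?thesis
    by simp
qed

text \<open>
  The equations of the theorem hold for the vectors of an open set only; differentiating them there
  yields identities between coefficients.
\<close>

lemma linear_form_eq_0:
  assumes "open V" "(y0 :: real^'n) \<in> V" "\<And>y. y \<in> V \<Longrightarrow> (\<Sum>a\<in>UNIV. p a * y $ a) = 0"
  shows "p i = 0"
proof -
  have "((\<lambda>y. 0) has_derivative (\<lambda>v. \<Sum>a\<in>UNIV. p a * v $ a)) (at y0)"
    using has_derivative_transform_within_open[OF has_derivative_linear_form assms(1,2,3)] .
  from fun_cong[OF has_derivative_unique[OF this has_derivative_const], of "axis i 1"] show ?thesis
    by (simp add: axis_def if_distrib[of "\<lambda>x. _ * x"] cong: if_cong)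
qed

lemma quadratic_form_eq_0:
  assumes "open V" "(y0 :: real^'n) \<in> V"
    "\<And>y. y \<in> V \<Longrightarrow> (\<Sum>a\<in>UNIV. \<Sum>b\<in>UNIV. M a b * y $ a * y $ b) = 0"
  shows "M i j + M j i = 0"
proof (rule linear_form_eq_0[OF assms(1,2), of "\<lambda>j. M i j + M j i"])
  fix y assume y: "y \<in> V"
  have "((\<lambda>y. 0) has_derivative (\<lambda>v. \<Sum>a\<in>UNIV. (\<Sum>b\<in>UNIV. (M a b + M b a) * y $ b) * v $ a)) (at y)"
    using has_derivative_transform_within_open[OF has_derivative_quadratic_form assms(1) y assms(3)] .
  from fun_cong[OF has_derivative_unique[OF this has_derivative_const], of "axis i 1"]
  show "(\<Sum>j\<in>UNIV. (M i j + M j i) * y $ j) = 0"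
    by (simp add: axis_def if_distrib[of "\<lambda>x. _ * x"] cong: if_cong)
qed

section \<open>The field equations on a single fibre\<close>

lemma open_inter_nonzero_coordinate:
  assumes "open V" "(y0 :: real^'n) \<in> V"
  obtains y1 where "y1 \<in> V" "y1 $ j \<noteq> 0" "open (V \<inter> {y. y $ j \<noteq> 0})"
proof -
  have op: "open (V \<inter> {y. y $ j \<noteq> 0})"
    using assms(1) by (intro open_Int open_Collect_neq continuous_intros)
  have "\<exists>y\<in>V. y $ j \<noteq> 0"
  proof (rule ccontr)
    assume "\<not> ?thesis"
    then show False
      using linear_form_eq_0[OF assms, of "kronecker j" j] by (simp, simp add: kronecker_def)
  qed
  then show thesis
    using that op by blast
qed

text \<open>
  Unique factorization for products of linear forms: \<open>y\<^sup>j\<close> divides the left-hand side but not the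
  form \<open>y\<^sup>k\<close>, hence it divides the form with coefficients \<open>p\<close>.
\<close>

lemma proportional_linear_forms:
  assumes V: "open V" "(y0 :: real^'n::finite) \<in> V" and jk: "j \<noteq> k"
    and eq: "\<And>y. y \<in> V \<Longrightarrow> (\<Sum>a\<in>UNIV. p a * y $ a) * y $ k = (\<Sum>a\<in>UNIV. q a * y $ a) * y $ j"
  shows "p a = p j * kronecker j a" and "p j = q k"
proof -
  have *: "(p a * kronecker k b - q a * kronecker j b) + (p b * kronecker k a - q b * kronecker j a) = 0" for a b
  proof (rule quadratic_form_eq_0[OF V, of "\<lambda>a b. p a * kronecker k b - q a * kronecker j b"])
    fix y :: "real^'n" assume y: "y \<in> V"
    have "(\<Sum>a\<in>UNIV. \<Sum>b\<in>UNIV. (p a * kronecker k b - q a * kronecker j b) * y $ a * y $ b)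
        = (\<Sum>a\<in>UNIV. \<Sum>b\<in>UNIV. (p a * y $ a) * (kronecker k b * y $ b) - (q a * y $ a) * (kronecker j b * y $ b))"
      by (simp add: algebra_simps)
    also have "\<dots> = (\<Sum>a\<in>UNIV. p a * y $ a) * y $ k - (\<Sum>a\<in>UNIV. q a * y $ a) * y $ j"
      by (simp only: sum_subtractf sum_distrib_left[symmetric] sum_kronecker sum_distrib_right[symmetric])
    finally show "(\<Sum>a\<in>UNIV. \<Sum>b\<in>UNIV. (p a * kronecker k b - q a * kronecker j b) * y $ a * y $ b) = 0"
      using eq[OF y] by simp
  qed
  show "p j = q k"
    using *[of j k] jk by (simp add: kronecker_def)
  show "p a = p j * kronecker j a"
    using *[of a k] *[of k k] jk by (auto simp: kronecker_def split: if_splits)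
qed

text \<open>
  The algebra behind the uniqueness of the Levi-Civita connection: going round with the two
  exchanges of indices returns the entry with the opposite sign.
\<close>

lemma antisym_sym_eq_0:
  fixes K :: "'n \<Rightarrow> 'n \<Rightarrow> 'n \<Rightarrow> real"
  assumes "\<And>j i a. K j i a = - K a i j" and "\<And>j i a. K j i a = K j a i"
  shows "K j i a = 0"
  using assms by (smt (verit))

text \<open>
  The algebraic content of the affine equation, in the tangent space at one point: \<open>J k i a\<close> stands
  for \<open>J\<^sup>k\<^sub>i\<^sub>a\<close> in \<open>J\<^sub>i\<^sup>k = J\<^sup>k\<^sub>i\<^sub>a(x) y\<^sup>a\<close>, \<open>P i y\<close> is \<open>y\<^sub>k J\<^sub>i\<^sup>k\<close>, and \<open>Q\<close> is the metric \<open>L\<close>. The Landsberg and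
  Cartan terms are absent because they vanish for a pseudo-Riemannian metric.

  Let \<open>\<tau>\<close> be the torsion \<open>J\<^sup>j\<^sub>i\<^sub>a - J\<^sup>j\<^sub>a\<^sub>i\<close>. For \<open>j \<noteq> i\<close> the equation reads \<open>T\<^sub>i y\<^sup>j = \<tau>\<^sup>j\<^sub>i\<^sub>a y\<^sup>a\<close>, where \<open>T\<^sub>i\<close>
  is the same rational function for all \<open>j\<close>. As \<open>n \<ge> 3\<close>, there are two such indices \<open>j\<close> and \<open>k\<close>, and
  cross-multiplication removes \<open>T\<^sub>i\<close>: the two linear forms are proportional to \<open>y\<^sup>j\<close> and \<open>y\<^sup>k\<close> with a
  common factor \<open>t\<^sub>i\<close>. Hence \<open>T\<^sub>i = t\<^sub>i\<close> is constant on the fibre, which says two things: \<open>P\<^sub>i = B\<^sub>i Q\<close>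
  for a constant \<open>B\<^sub>i\<close>, and \<open>\<tau>\<^sup>j\<^sub>i\<^sub>a = t\<^sub>i \<delta>\<^sup>j\<^sub>a - t\<^sub>a \<delta>\<^sup>j\<^sub>i\<close>.

  Lower the upper index of \<open>J\<close>. The first relation gives its part symmetric in the first and last
  index, the second one its part skew in the last two, and together they determine it as
  \<open>B\<^sub>i g\<^sub>l\<^sub>a + D\<^sub>l g\<^sub>i\<^sub>a - D\<^sub>a g\<^sub>i\<^sub>l\<close> with \<open>D = t - B\<close>. Taking the traces that occur in \<open>S\<close> yields
  \<open>(n - 2) D = 0\<close>, so that only the term of \<open>B\<close> survives.
\<close>

lemma liouville_of_affine_equation:
  fixes g h :: "'n::finite \<Rightarrow> 'n \<Rightarrow> real" and J :: "'n \<Rightarrow> 'n \<Rightarrow> 'n \<Rightarrow> real"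
    and V :: "(real^'n) set"
  defines "n \<equiv> real CARD('n)"
  defines "Q \<equiv> \<lambda>y :: real^'n. \<Sum>a\<in>UNIV. \<Sum>b\<in>UNIV. g a b * y $ a * y $ b"
  defines "P \<equiv> \<lambda>i (y :: real^'n). \<Sum>a\<in>UNIV. (\<Sum>m\<in>UNIV. g a m * y $ m) * (\<Sum>m\<in>UNIV. J a i m * y $ m)"
  defines "S \<equiv> \<lambda>b. \<Sum>a\<in>UNIV. J a b a + J a a b"
  defines "T \<equiv> \<lambda>b y. (n + 2) * (P b y / Q y) - S b"
  assumes dim: "CARD('n) \<ge> 3"
    and V: "open V" "y0 \<in> V"
    and sym: "\<And>i j. g i j = g j i"
    and inverse: "\<And>i j. (\<Sum>k\<in>UNIV. h i k * g k j) = kronecker i j"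
      "\<And>i j. (\<Sum>k\<in>UNIV. g i k * h k j) = kronecker i j"
    and pos: "\<And>y. y \<in> V \<Longrightarrow> Q y > 0"
    and eq: "\<And>y i j. y \<in> V \<Longrightarrow> T i y * y $ j - (\<Sum>b\<in>UNIV. T b y * y $ b) * kronecker j i
       = (\<Sum>a\<in>UNIV. (J j i a - J j a i) * y $ a)"
  shows "\<exists>B. \<forall>k i a. J k i a = B i * kronecker k a"
proof -
  define \<tau> where "\<tau> j i a = J j i a - J j a i" for j i a
  define H where "H l i a = (\<Sum>k\<in>UNIV. g l k * J k i a)" for l i a
  have third: "\<exists>k. k \<noteq> i \<and> k \<noteq> j" for i j :: 'n
  proof (rule ccontr)
    assume "\<not> ?thesis"
    then have "UNIV = {i, j}"
      by blast
    then have "CARD('n) = card {i, j}"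
      by simp
    also have "\<dots> \<le> 2"
      by (simp add: card_insert_if)
    finally have "CARD('n) \<le> 2" .
    then show False
      using dim by simp
  qed
  have offdiag: "T i y * y $ j = (\<Sum>a\<in>UNIV. \<tau> j i a * y $ a)" if "j \<noteq> i" "y \<in> V" for i j y
    using eq[OF that(2), of i j] that(1) by (simp add: kronecker_def \<tau>_def)
  have column: "\<tau> j i a = \<tau> j i j * kronecker j a" "\<tau> j i j = \<tau> k i k"
    if "j \<noteq> i" "k \<noteq> i" "j \<noteq> k" for i j k a
  proof -
    have *: "(\<Sum>a\<in>UNIV. \<tau> j i a * y $ a) * y $ k = (\<Sum>a\<in>UNIV. \<tau> k i a * y $ a) * y $ j"
      if y: "y \<in> V" for y
      unfolding offdiag[OF \<open>j \<noteq> i\<close> y, symmetric] offdiag[OF \<open>k \<noteq> i\<close> y, symmetric]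
      by (simp add: mult_ac)
    show "\<tau> j i a = \<tau> j i j * kronecker j a" "\<tau> j i j = \<tau> k i k"
      using proportional_linear_forms[OF V that(3) *] by blast+
  qed
  have "\<exists>t. \<forall>j a. j \<noteq> i \<longrightarrow> \<tau> j i a = t * kronecker j a" for i
  proof -
    obtain j0 where j0: "j0 \<noteq> i"
      using third by blast
    have "\<tau> j i a = \<tau> j0 i j0 * kronecker j a" if "j \<noteq> i" for j a
    proof -
      obtain k where k: "k \<noteq> i" "k \<noteq> j"
        using third by blast
      have "\<tau> j i a = \<tau> j i j * kronecker j a"
        using column(1)[OF that k(1)] k(2) by metis
      moreover have "\<tau> j i j = \<tau> j0 i j0"
        using column(2)[OF that j0] by (cases "j = j0") simp_all
      ultimately show ?thesis
        by simp
    qed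
    then show ?thesis
      by blast
  qed
  then obtain t where t: "\<And>i j a. j \<noteq> i \<Longrightarrow> \<tau> j i a = t i * kronecker j a"
    by metis
  define B where "B i = (t i + S i) / (n + 2)" for i
  have n: "n \<ge> 3" and B: "(n + 2) * B i = t i + S i" for i
    using dim by (simp_all add: n_def B_def)
  have P_H: "P i y = (\<Sum>l\<in>UNIV. \<Sum>a\<in>UNIV. H l i a * y $ l * y $ a)" for i y
  proof -
    have "P i y = (\<Sum>k\<in>UNIV. \<Sum>l\<in>UNIV. \<Sum>a\<in>UNIV. g l k * J k i a * y $ l * y $ a)"
      unfolding P_def sum_product by (intro sum.cong refl) (simp add: sym mult_ac)
    also have "\<dots> = (\<Sum>l\<in>UNIV. \<Sum>k\<in>UNIV. \<Sum>a\<in>UNIV. g l k * J k i a * y $ l * y $ a)"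
      by (rule sum.swap)
    also have "\<dots> = (\<Sum>l\<in>UNIV. \<Sum>a\<in>UNIV. \<Sum>k\<in>UNIV. g l k * J k i a * y $ l * y $ a)"
      by (intro sum.cong refl sum.swap)
    finally show ?thesis
      by (simp add: H_def sum_distrib_right)
  qed
  have H_sym: "H l i a + H a i l = 2 * B i * g l a" for l i a
  proof -
    obtain j where j: "j \<noteq> i"
      using third by blast
    \<comment> \<open>\<open>T\<^sub>i y\<^sup>j = t\<^sub>i y\<^sup>j\<close> can be divided by \<open>y\<^sup>j\<close> on a smaller open set, which suffices for the
      coefficients of the quadratic forms \<open>P\<^sub>i\<close> and \<open>B\<^sub>i Q\<close> to be equal.\<close>
    obtain y1 where y1: "y1 \<in> V" "y1 $ j \<noteq> 0" and op: "open (V \<inter> {y. y $ j \<noteq> 0})"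
      using open_inter_nonzero_coordinate[OF V] by metis
    have "(\<Sum>l\<in>UNIV. \<Sum>a\<in>UNIV. (H l i a - B i * g l a) * y $ l * y $ a) = 0" if "y \<in> V \<inter> {y. y $ j \<noteq> 0}" for y
    proof -
      have y: "y \<in> V" "y $ j \<noteq> 0"
        using that by auto
      have "T i y = t i"
        using offdiag[OF j y(1)] y(2) by (simp add: t[OF j] mult.assoc flip: sum_distrib_left)
      then have "(n + 2) * P i y = (t i + S i) * Q y"
        using pos[OF y(1)] by (simp add: T_def field_simps)
      also have "\<dots> = (n + 2) * (B i * Q y)"
        unfolding B[symmetric] by simp
      finally have "P i y = B i * Q y"
        using n by simp
      then show ?thesis
        by (simp add: P_H Q_def sum_subtractf sum_distrib_left algebra_simps)
    qed
    then show ?thesis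
      using quadratic_form_eq_0[OF op, of y1 "\<lambda>l a. H l i a - B i * g l a" l a] y1 sym[of l a]
      by (simp add: algebra_simps)
  qed
  have P_B: "P i y = B i * Q y" for i y
  proof -
    have "P i y = (\<Sum>l\<in>UNIV. \<Sum>a\<in>UNIV. H a i l * y $ l * y $ a)"
      unfolding P_H by (subst sum.swap) (simp add: mult_ac)
    then have "2 * P i y = (\<Sum>l\<in>UNIV. \<Sum>a\<in>UNIV. (H l i a + H a i l) * y $ l * y $ a)"
      unfolding P_H by (simp add: sum.distrib algebra_simps)
    also have "\<dots> = 2 * (B i * Q y)"
      unfolding H_sym Q_def sum_distrib_left by (simp add: mult_ac)
    finally show ?thesis
      by simp
  qed
  \<comment> \<open>The coefficients being equal, the restriction to nonzero \<open>y\<^sup>j\<close> can be dropped.\<close>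
  have T_t: "T i y = t i" if "y \<in> V" for i y
    using pos[OF that] B[of i] by (simp add: T_def P_B)
  have \<tau>: "\<tau> j i a = t i * kronecker j a - t a * kronecker j i" for j i a
  proof (cases "j = i")
    case True
    \<comment> \<open>The diagonal equation involves every \<open>T\<^sub>b\<close>, now all known to be constant.\<close>
    have "t i * kronecker i a - t a - \<tau> i i a = 0"
    proof (rule linear_form_eq_0[OF V, of "\<lambda>a. t i * kronecker i a - t a - \<tau> i i a"])
      fix y assume "y \<in> V"
      then show "(\<Sum>a\<in>UNIV. (t i * kronecker i a - t a - \<tau> i i a) * y $ a) = 0"
        using eq[of y i i]
        by (simp add: T_t \<tau>_def kronecker_def[of i i] left_diff_distrib sum_subtractf mult.assoc
            flip: sum_distrib_left)
    qed
    then show ?thesis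
      using True by (simp add: kronecker_def)
  next
    case False
    then show ?thesis
      using t[OF False] by (simp add: kronecker_def)
  qed
  have H_skew: "H l i a - H l a i = t i * g l a - t a * g l i" for l i a
  proof -
    have "H l i a - H l a i = (\<Sum>k\<in>UNIV. g l k * \<tau> k i a)"
      by (simp add: H_def \<tau>_def sum_subtractf algebra_simps)
    also have "\<dots> = (\<Sum>k\<in>UNIV. t i * (g l k * kronecker k a) - t a * (g l k * kronecker k i))"
      by (simp add: \<tau> algebra_simps)
    finally show ?thesis
      by (simp only: sum_subtractf sum_distrib_left[symmetric] sum_kronecker)
  qed
  define D where "D i = t i - B i" for i
  have H_D: "H l i a = B i * g l a + D l * g i a - D a * g i l" for l i a
  proof -
    have "H l i a - B i * g l a - D l * g i a + D a * g i l = 0"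
    proof (rule antisym_sym_eq_0[of "\<lambda>l i a. H l i a - B i * g l a - D l * g i a + D a * g i l"])
      show "H l i a - B i * g l a - D l * g i a + D a * g i l
          = - (H a i l - B i * g a l - D a * g i l + D l * g i a)" for l i a
        using H_sym[of l i a] sym[of a l] by (simp add: algebra_simps)
      show "H l i a - B i * g l a - D l * g i a + D a * g i l
          = H l a i - B a * g l i - D l * g a i + D i * g a l" for l i a
        using H_skew[of l i a] sym[of a l] sym[of l i] sym[of a i] by (simp add: D_def algebra_simps)
    qed
    then show ?thesis
      by simp
  qed
  define D' where "D' k = (\<Sum>l\<in>UNIV. h k l * D l)" for k
  have J_H: "J k i a = (\<Sum>l\<in>UNIV. h k l * H l i a)" for k i a
  proof -
    have "(\<Sum>l\<in>UNIV. h k l * H l i a) = (\<Sum>m\<in>UNIV. (\<Sum>l\<in>UNIV. h k l * g l m) * J m i a)"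
      unfolding H_def sum_distrib_left sum_distrib_right
      by (subst sum.swap) (simp add: mult_ac)
    then show ?thesis
      by (simp add: inverse)
  qed
  have J_D: "J k i a = B i * kronecker k a + D' k * g i a - D a * kronecker k i" for k i a
  proof -
    have "J k i a = (\<Sum>l\<in>UNIV. B i * (h k l * g l a) + h k l * D l * g i a - D a * (h k l * g l i))"
      unfolding J_H H_D by (intro sum.cong refl) (simp add: sym[of i] algebra_simps)
    then show ?thesis
      by (simp add: sum.distrib sum_subtractf inverse D'_def flip: sum_distrib_left sum_distrib_right)
  qed
  have D_0: "D b = 0" for b
  proof -
    have lower: "(\<Sum>a\<in>UNIV. D' a * g b a) = D b"
    proof -
      have "(\<Sum>a\<in>UNIV. D' a * g b a) = (\<Sum>l\<in>UNIV. (\<Sum>a\<in>UNIV. g b a * h a l) * D l)"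
        unfolding D'_def sum_distrib_right by (subst sum.swap) (simp add: mult_ac)
      then show ?thesis
        by (simp add: inverse)
    qed
    have "S b = (\<Sum>a\<in>UNIV. B b + D' a * g b a - D a * kronecker a b + B a * kronecker a b + D' a * g b a - D b)"
      unfolding S_def J_D by (intro sum.cong refl) (simp add: kronecker_def[of a a for a] sym[of _ b])
    then have "S b = n * B b + D b - D b + B b + D b - n * D b"
      by (simp only: sum.distrib sum_subtractf sum_kronecker lower sum_constant n_def)
    moreover have "(n + 2) * B b = B b + D b + S b"
      using B[of b] by (simp add: D_def)
    ultimately have "n * D b = 2 * D b"
      by (simp add: distrib_right)
    then show ?thesis
      using n by simp
  qed
  have "J k i a = B i * kronecker k a" for k i a
    by (simp add: J_D D_0 D'_def)
  then show ?thesis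
    by blast
qed

text \<open>
  A quadratic Ricci scalar has constant second vertical derivatives, so the metric equation makes it
  a constant multiple \<open>c L\<close> of the metric. Taking the trace of the coefficients gives \<open>(n + 2) c = 2 n c\<close>,
  and \<open>c = 0\<close>.
\<close>

lemma ricci_flat_of_metric_equation:
  fixes g h r :: "'n::finite \<Rightarrow> 'n \<Rightarrow> real" and V :: "(real^'n) set"
  defines "n \<equiv> real CARD('n)"
  defines "Q \<equiv> \<lambda>M (y :: real^'n). \<Sum>a\<in>UNIV. \<Sum>b\<in>UNIV. M a b * y $ a * y $ b"
  assumes dim: "CARD('n) \<ge> 3"
    and V: "open V" "y0 \<in> V"
    and sym: "\<And>i j. g i j = g j i"
    and inverse: "\<And>i j. (\<Sum>k\<in>UNIV. h i k * g k j) = kronecker i j"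
    and eq: "\<And>y. y \<in> V \<Longrightarrow> (n + 2) * Q r y - Q g y * (\<Sum>a\<in>UNIV. \<Sum>b\<in>UNIV. h a b * (r a b + r b a)) = 0"
  shows "Q r y = 0"
proof -
  define s where "s = (\<Sum>a\<in>UNIV. \<Sum>b\<in>UNIV. h a b * (r a b + r b a))"
  have r: "(n + 2) * (r a b + r b a) = 2 * s * g a b" for a b
  proof -
    have "((n + 2) * r a b - s * g a b) + ((n + 2) * r b a - s * g b a) = 0"
    proof (rule quadratic_form_eq_0[OF V, of "\<lambda>a b. (n + 2) * r a b - s * g a b"])
      fix y assume "y \<in> V"
      then show "(\<Sum>a\<in>UNIV. \<Sum>b\<in>UNIV. ((n + 2) * r a b - s * g a b) * y $ a * y $ b) = 0"
        using eq[of y] unfolding s_def[symmetric]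
        by (simp add: Q_def sum_subtractf sum_distrib_left algebra_simps)
    qed
    then show ?thesis
      using sym[of b a] by (simp add: algebra_simps)
  qed
  have "(n + 2) * s = (\<Sum>a\<in>UNIV. \<Sum>b\<in>UNIV. 2 * s * (h a b * g b a))"
    unfolding s_def[THEN arg_cong[where f = "\<lambda>s. (n + 2) * s"]] sum_distrib_left
    by (intro sum.cong refl) (use r sym in \<open>simp add: mult.left_commute[of "n + 2"] mult_ac\<close>)
  also have "\<dots> = 2 * s * n"
    by (simp add: inverse kronecker_def n_def flip: sum_distrib_left)
  finally have "(n - 2) * s = 0"
    by (simp add: algebra_simps)
  then have "s = 0"
    using dim by (simp add: n_def)
  then have "r a b + r b a = 0" for a b
    using r[of a b] by (simp add: n_def)
  moreover have "2 * Q r y = (\<Sum>a\<in>UNIV. \<Sum>b\<in>UNIV. (r a b + r b a) * y $ a * y $ b)"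
  proof -
    have "Q r y = (\<Sum>a\<in>UNIV. \<Sum>b\<in>UNIV. r b a * y $ a * y $ b)"
      unfolding Q_def by (subst sum.swap) (simp add: mult_ac)
    then show ?thesis
      by (simp add: Q_def sum.distrib algebra_simps)
  qed
  ultimately show ?thesis
    by simp
qed

section \<open>Fields that are polynomial along the fibres\<close>

text \<open>
  The coefficients are functions on \<open>U\<close>, although they depend on \<open>x\<close> only: they arise as vertical
  derivatives of fields, and they are differentiated along the base by the same operator \<open>dx\<close>.
\<close>

definition fibre_linear :: "((real^'n::finite) \<times> (real^'n)) set \<Rightarrow> 'n fn \<Rightarrow> ('n \<Rightarrow> 'n fn) \<Rightarrow> bool" where
  "fibre_linear U F G \<longleftrightarrow>
     (\<forall>a. isotropic_on U (G a)) \<and> (\<forall>z\<in>U. F z = (\<Sum>a\<in>UNIV. G a z * snd z $ a))"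

lemma dy_fibre_linear:
  assumes "open U" "z \<in> U" "F differentiable (at z)" "fibre_linear U F G"
  shows "dy i F z = G i z"
proof -
  obtain x y where z: "z = (x, y)" by (cases z)
  have "dy i F (x, y) = (\<Sum>a\<in>UNIV. G a (x, y) * axis i 1 $ a)"
  proof (rule dy_eq_fibreI[OF assms(1)])
    show "F (x, y') = (\<Sum>a\<in>UNIV. G a (x, y) * y' $ a)" if "(x, y') \<in> U" for y'
    proof -
      have "G a (x, y') = G a (x, y)" for a
        using assms(2,4) that unfolding z fibre_linear_def by (blast intro: isotropic_onD)
      then show ?thesis
        using assms(4) that by (simp add: fibre_linear_def)
    qed
  qed (use assms z has_derivative_linear_form in auto)
  then show ?thesis
    by (simp add: z axis_def if_distrib[of "\<lambda>x. _ * x"] cong: if_cong)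
qed

lemma dy_fibre_quadratic:
  assumes "open U" "(x, y) \<in> U" "F differentiable (at (x, y))"
    and "\<And>a b. isotropic_on U (M a b)"
    and "\<And>z. z \<in> U \<Longrightarrow> F z = (\<Sum>a\<in>UNIV. \<Sum>b\<in>UNIV. M a b z * snd z $ a * snd z $ b)"
  shows "dy i F (x, y) = (\<Sum>b\<in>UNIV. (M i b (x, y) + M b i (x, y)) * y $ b)"
proof -
  have "dy i F (x, y) = (\<Sum>a\<in>UNIV. (\<Sum>b\<in>UNIV. (M a b (x, y) + M b a (x, y)) * y $ b) * axis i 1 $ a)"
  proof (rule dy_eq_fibreI[OF assms(1-3) _ has_derivative_quadratic_form])
    fix y' assume y': "(x, y') \<in> U"
    have "M a b (x, y') = M a b (x, y)" for a b
      using isotropic_onD[OF assms(4) y' assms(2)] .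
    then show "F (x, y') = (\<Sum>a\<in>UNIV. \<Sum>b\<in>UNIV. M a b (x, y) * y' $ a * y' $ b)"
      using assms(5)[OF y'] by simp
  qed
  then show ?thesis
    by (simp add: axis_def if_distrib[of "\<lambda>x. _ * x"] cong: if_cong)
qed

section \<open>Pseudo-Riemannian metrics in a chart\<close>

lemma differentiable_prod:
  fixes f :: "'i \<Rightarrow> 'a::real_normed_vector \<Rightarrow> real"
  assumes "\<And>i. i \<in> I \<Longrightarrow> f i differentiable (at z)"
  shows "(\<lambda>z. \<Prod>i\<in>I. f i z) differentiable (at z)"
  using assms by (induction I rule: infinite_finite_induct) auto

lemma differentiable_det:
  fixes M :: "'a::real_normed_vector \<Rightarrow> real^'n^'n"
  assumes "\<And>i j. (\<lambda>z. M z $ i $ j) differentiable (at z)"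
  shows "(\<lambda>z. det (M z)) differentiable (at z)"
  unfolding det_def
  by (intro differentiable_sum ballI finite_permutations finite_class.finite_UNIV differentiable_mult
      differentiable_const differentiable_prod assms)

text \<open>
  Cramer's rule makes the entries of the inverse rational functions of the entries of the matrix.
  The spray contains the inverse metric, and its vertical derivative is a derivative in the full
  sense, so differentiability of the inverse metric in both \<open>x\<close> and \<open>y\<close> is required.
\<close>

lemma matrix_inv_cramer:
  fixes G :: "real^'n^'n"
  assumes "invertible G"
  shows "matrix_inv G $ i $ j = det (\<chi> r s. if s = i then axis j 1 $ r else G $ r $ s) / det G"
proof -
  have "G ** matrix_inv G = mat 1"
    using assms unfolding invertible_def matrix_inv_def by (rule someI2_ex) blast
  then have "G *v (matrix_inv G *v axis j 1) = axis j 1"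
    by (simp add: matrix_vector_mul_assoc)
  then have "matrix_inv G *v axis j 1 = (\<chi> k. det (\<chi> r s. if s = k then axis j 1 $ r else G $ r $ s) / det G)"
    using assms by (subst (asm) cramer) (simp_all add: invertible_det_nz)
  then have "(matrix_inv G *v axis j 1) $ i = det (\<chi> r s. if s = i then axis j 1 $ r else G $ r $ s) / det G"
    by simp
  then show ?thesis
    by (simp add: matrix_vector_mult_basis column_def)
qed

definition christoffel :: "'n::finite fn \<Rightarrow> 'n \<Rightarrow> 'n \<Rightarrow> 'n \<Rightarrow> 'n fn" where
  "christoffel L k i j z = 1 / 2 * (\<Sum>a\<in>UNIV. g_inv L k a z *
     (dx i (g_low L a j) z + dx j (g_low L a i) z - dx a (g_low L i j) z))"

text \<open>
  \<open>U\<close> is the domain of the coordinates \<open>(x, y)\<close> of a chart and \<open>L\<close> the representative of the metric.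
\<close>

locale pseudo_riemannian_chart =
  fixes U :: "((real^'n::finite) \<times> (real^'n)) set" and L :: "'n fn"
  assumes open_U: "open U"
    and conic: "(x, y) \<in> U \<Longrightarrow> t > 0 \<Longrightarrow> (x, t *\<^sub>R y) \<in> U"
    and smooth_L: "smooth_on U L"
    and homogeneous_L: "(x, y) \<in> U \<Longrightarrow> t > 0 \<Longrightarrow> L (x, t *\<^sub>R y) = t ^ 2 * L (x, y)"
    and pos_L: "z \<in> U \<Longrightarrow> L z > 0"
    and invertible_g: "z \<in> U \<Longrightarrow> invertible (g_matrix L z)"
    and isotropic_g_matrix: "(x, y) \<in> U \<Longrightarrow> (x, y') \<in> U \<Longrightarrow> g_matrix L (x, y) = g_matrix L (x, y')"
begin

lemma g_low_eq: "g_low L i j = (\<lambda>z. 1 / 2 * dy j (dy i L) z)"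
  by (simp add: g_low_def g_matrix_def fun_eq_iff)

lemma smooth_g_low: "smooth_on U (g_low L i j)"
  unfolding g_low_eq
  by (intro smooth_on_mult smooth_on_const smooth_on_dy open_U smooth_L)

lemma differentiable_g_low: "z \<in> U \<Longrightarrow> g_low L i j differentiable (at z)"
  using smooth_g_low by (rule smooth_on_differentiable)

lemma differentiable_dx_g_low: "z \<in> U \<Longrightarrow> dx k (g_low L i j) differentiable (at z)"
  using smooth_on_dx[OF smooth_g_low] by (rule smooth_on_differentiable)

lemma isotropic_g_low: "isotropic_on U (g_low L i j)"
  by (rule isotropic_onI) (metis g_low_def isotropic_g_matrix)

lemma isotropic_g_inv: "isotropic_on U (g_inv L i j)"
  by (rule isotropic_onI) (metis g_inv_def isotropic_g_matrix)

lemma isotropic_dx_g_low: "isotropic_on U (dx k (g_low L i j))"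
  using dx_isotropic[OF open_U differentiable_g_low isotropic_g_low] .

lemma
  assumes "z \<in> U"
  shows g_inv_g_low: "(\<Sum>k\<in>UNIV. g_inv L i k z * g_low L k j z) = kronecker i j"
    and g_low_g_inv: "(\<Sum>k\<in>UNIV. g_low L i k z * g_inv L k j z) = kronecker i j"
proof -
  have "g_matrix L z ** matrix_inv (g_matrix L z) = mat 1 \<and> matrix_inv (g_matrix L z) ** g_matrix L z = mat 1"
    using invertible_g[OF assms] unfolding invertible_def matrix_inv_def by (rule someI_ex)
  then show "(\<Sum>k\<in>UNIV. g_inv L i k z * g_low L k j z) = kronecker i j"
    "(\<Sum>k\<in>UNIV. g_low L i k z * g_inv L k j z) = kronecker i j"
    by (simp_all add: vec_eq_iff matrix_matrix_mult_def mat_def g_inv_def g_low_def kronecker_def)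
qed

lemma differentiable_g_inv:
  assumes "z \<in> U"
  shows "g_inv L i j differentiable (at z)"
proof (rule differentiable_transform_within_open[OF _ open_U assms])
  let ?M = "\<lambda>w. \<chi> r s. if s = i then axis j 1 $ r else g_matrix L w $ r $ s"
  have g: "(\<lambda>w. g_matrix L w $ r $ s) differentiable (at z)" for r s
    using differentiable_g_low[OF assms, of r s] by (simp add: g_low_def[abs_def])
  have "(\<lambda>w. ?M w $ r $ s) differentiable (at z)" for r s
    using g by (cases "s = i") simp_all
  then show "(\<lambda>w. det (?M w) / det (g_matrix L w)) differentiable (at z)"
    using invertible_g[OF assms] g
    by (intro differentiable_divide differentiable_det) (simp_all add: invertible_det_nz)
  show "det (?M w) / det (g_matrix L w) = g_inv L i j w" if "w \<in> U" for w
    using matrix_inv_cramer[OF invertible_g[OF that]] by (simp add: g_inv_def)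
qed

text \<open>\<open>\<partial>L/\<partial>y\<^sup>i\<close> is \<open>1\<close>-homogeneous, and \<open>2 g\<^sub>i\<^sub>a\<close> are its vertical derivatives: Euler's identity.\<close>

lemma dy_L:
  assumes "z \<in> U"
  shows "dy i L z = 2 * (\<Sum>a\<in>UNIV. g_low L i a z * snd z $ a)"
proof -
  obtain x y where z: "z = (x, y)" by (cases z)
  have "(\<Sum>a\<in>UNIV. dy a (dy i L) (x, y) * y $ a) = real 1 * dy i L (x, y)"
  proof (rule euler_identity)
    show "dy i L differentiable (at (x, y))"
      using assms z smooth_on_differentiable[OF smooth_on_dy[OF smooth_L]] by simp
    show "dy i L (x, t *\<^sub>R y) = t ^ 1 * dy i L (x, y)" if "t > 0" for t
      by (rule dy_homogeneous[OF open_U])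
        (use assms z that conic homogeneous_L smooth_on_differentiable[OF smooth_L] in
          \<open>simp_all add: numeral_2_eq_2\<close>)
  qed
  then show ?thesis
    by (simp add: z g_low_eq sum_distrib_left)
qed

lemma L_eq:
  assumes "z \<in> U"
  shows "L z = (\<Sum>i\<in>UNIV. \<Sum>a\<in>UNIV. g_low L i a z * snd z $ i * snd z $ a)"
proof -
  obtain x y where z: "z = (x, y)" by (cases z)
  have "(\<Sum>i\<in>UNIV. dy i L (x, y) * y $ i) = real 2 * L (x, y)"
    using assms z conic homogeneous_L smooth_on_differentiable[OF smooth_L]
    by (intro euler_identity) auto
  also have "(\<Sum>i\<in>UNIV. dy i L (x, y) * y $ i)
      = 2 * (\<Sum>i\<in>UNIV. \<Sum>a\<in>UNIV. g_low L i a z * y $ i * y $ a)"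
    using dy_L[OF assms] unfolding z sum_distrib_left by (simp add: sum_distrib_left mult_ac)
  finally show ?thesis
    by (simp add: z)
qed

text \<open>
  On a fibre \<open>L\<close> is the quadratic form with constant coefficients \<open>g\<^sub>i\<^sub>a\<close>, so its derivative is
  \<open>(g\<^sub>i\<^sub>a + g\<^sub>a\<^sub>i) y\<^sup>a\<close>; by homogeneity the derivative is also \<open>2 g\<^sub>i\<^sub>a y\<^sup>a\<close>.
\<close>

lemma g_low_sym:
  assumes "z \<in> U"
  shows "g_low L i j z = g_low L j i z"
proof -
  obtain x y where z: "z = (x, y)" by (cases z)
  have "g_low L j i z - g_low L i j z = 0"
  proof (rule linear_form_eq_0[OF open_fibre[OF open_U, of x], of y "\<lambda>j. g_low L j i z - g_low L i j z"])
    show "y \<in> {y. (x, y) \<in> U}"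
      using assms z by simp
    fix y' assume "y' \<in> {y. (x, y) \<in> U}"
    then have y': "(x, y') \<in> U"
      by simp
    have g: "g_low L i j (x, y') = g_low L i j z" for i j
      using isotropic_onD[OF isotropic_g_low y'] assms z by blast
    have "dy i L (x, y') = (\<Sum>b\<in>UNIV. (g_low L i b (x, y') + g_low L b i (x, y')) * y' $ b)"
      using dy_fibre_quadratic[OF open_U y' _ isotropic_g_low L_eq] y'
        smooth_on_differentiable[OF smooth_L y'] by blast
    then show "(\<Sum>j\<in>UNIV. (g_low L j i z - g_low L i j z) * y' $ j) = 0"
      using dy_L[OF y', of i]
      by (simp add: g sum.distrib sum_subtractf algebra_simps)
  qed
  then show ?thesis
    by simp
qed

lemma dx_g_low_sym: "z \<in> U \<Longrightarrow> dx k (g_low L i j) z = dx k (g_low L j i) z"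
  using dx_cong[OF open_U _ differentiable_g_low g_low_sym] by blast

lemma y_low_contract: "z \<in> U \<Longrightarrow> (\<Sum>a\<in>UNIV. y_low L a z * snd z $ a) = L z"
  using L_eq[of z] by (simp add: y_low_def sum_distrib_left sum_distrib_right mult_ac)

lemma mean_Cartan_eq_0: "z \<in> U \<Longrightarrow> mean_Cartan L i z = 0"
  using dy_isotropic[OF open_U _ differentiable_g_low isotropic_g_low]
  by (simp add: mean_Cartan_def)

lemma isotropic_christoffel: "isotropic_on U (christoffel L k i j)"
proof (rule isotropic_onI)
  fix x y y' assume *: "(x, y) \<in> U" "(x, y') \<in> U"
  show "christoffel L k i j (x, y) = christoffel L k i j (x, y')"
    unfolding christoffel_def isotropic_onD[OF isotropic_g_inv *] isotropic_onD[OF isotropic_dx_g_low *] ..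
qed

lemma differentiable_christoffel: "z \<in> U \<Longrightarrow> christoffel L k i j differentiable (at z)"
  unfolding christoffel_def[abs_def]
  by (intro differentiable_mult differentiable_const differentiable_sum ballI finite differentiable_add
      differentiable_diff differentiable_g_inv differentiable_dx_g_low)

text \<open>
  The spray is the quadratic form in \<open>y\<close> with coefficients \<open>\<gamma>\<close>; they are not symmetric, and the
  Christoffel symbols appear when the vertical derivative symmetrizes them.
\<close>

lemma canonical_conn_eq:
  assumes "z \<in> U"
  shows "canonical_conn L i k z = (\<Sum>b\<in>UNIV. christoffel L k i b z * snd z $ b)"
proof -
  obtain x y where z: "z = (x, y)" by (cases z)
  define \<gamma> where "\<gamma> b m w = (\<Sum>a\<in>UNIV. 1 / 4 * (g_inv L k a w * (2 * dx m (g_low L a b) w - dx a (g_low L b m) w)))" for b m w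
  have iso: "isotropic_on U (\<gamma> b m)" for b m
  proof (rule isotropic_onI)
    fix x y y' assume *: "(x, y) \<in> U" "(x, y') \<in> U"
    show "\<gamma> b m (x, y) = \<gamma> b m (x, y')"
      unfolding \<gamma>_def isotropic_onD[OF isotropic_g_inv *] isotropic_onD[OF isotropic_dx_g_low *] ..
  qed
  have spray: "spray L k w = (\<Sum>b\<in>UNIV. \<Sum>m\<in>UNIV. \<gamma> b m w * snd w $ b * snd w $ m)" for w
  proof -
    have "spray L k w = (\<Sum>a\<in>UNIV. \<Sum>b\<in>UNIV. \<Sum>m\<in>UNIV. 1 / 4 * (g_inv L k a w * (2 * dx m (g_low L a b) w - dx a (g_low L b m) w)) * snd w $ b * snd w $ m)"
      by (simp add: spray_def sum_distrib_left mult_ac)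
    also have "\<dots> = (\<Sum>b\<in>UNIV. \<Sum>a\<in>UNIV. \<Sum>m\<in>UNIV. 1 / 4 * (g_inv L k a w * (2 * dx m (g_low L a b) w - dx a (g_low L b m) w)) * snd w $ b * snd w $ m)"
      by (rule sum.swap)
    also have "\<dots> = (\<Sum>b\<in>UNIV. \<Sum>m\<in>UNIV. \<Sum>a\<in>UNIV. 1 / 4 * (g_inv L k a w * (2 * dx m (g_low L a b) w - dx a (g_low L b m) w)) * snd w $ b * snd w $ m)"
      by (intro sum.cong refl sum.swap)
    finally show ?thesis
      by (simp only: \<gamma>_def sum_distrib_right)
  qed
  have "spray L k differentiable (at z)"
    unfolding spray_def[abs_def] using assms
    by (intro differentiable_mult differentiable_const differentiable_sum ballI finite
      differentiable_diff differentiable_g_inv differentiable_dx_g_low differentiable_snd_nth)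
  then have "canonical_conn L i k z = (\<Sum>b\<in>UNIV. (\<gamma> i b z + \<gamma> b i z) * snd z $ b)"
    unfolding canonical_conn_def
    using dy_fibre_quadratic[OF open_U _ _ iso spray] assms by (simp add: z)
  moreover have "\<gamma> i b z + \<gamma> b i z = christoffel L k i b z" for b
    unfolding \<gamma>_def christoffel_def sum_distrib_left sum.distrib[symmetric]
    using dx_g_low_sym[OF assms, of _ b i] by (intro sum.cong refl) (simp add: algebra_simps)
  ultimately show ?thesis
    by simp
qed

lemma canonical_conn_fibre_linear: "fibre_linear U (canonical_conn L i k) (christoffel L k i)"
  by (simp add: fibre_linear_def isotropic_christoffel canonical_conn_eq)

lemma differentiable_canonical_conn:
  assumes "z \<in> U"
  shows "canonical_conn L i k differentiable (at z)"
proof (rule differentiable_transform_within_open[OF _ open_U assms])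
  show "(\<lambda>z. \<Sum>b\<in>UNIV. christoffel L k i b z * snd z $ b) differentiable (at z)"
    using assms by (intro differentiable_mult differentiable_sum ballI finite differentiable_christoffel
      differentiable_snd_nth)
qed (simp add: canonical_conn_eq)

lemma christoffel_lower:
  assumes "z \<in> U"
  shows "(\<Sum>a\<in>UNIV. christoffel L a k i z * g_low L a j z)
    = 1 / 2 * (dx k (g_low L j i) z + dx i (g_low L j k) z - dx j (g_low L k i) z)"
proof -
  define X where "X l = 1 / 2 * (dx k (g_low L l i) z + dx i (g_low L l k) z - dx l (g_low L k i) z)" for l
  have "(\<Sum>a\<in>UNIV. christoffel L a k i z * g_low L a j z)
      = (\<Sum>a\<in>UNIV. \<Sum>l\<in>UNIV. X l * (g_low L j a z * g_inv L a l z))"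
    unfolding christoffel_def sum_distrib_left sum_distrib_right
    by (intro sum.cong refl) (simp add: X_def g_low_sym[OF assms, of j] mult_ac)
  also have "\<dots> = (\<Sum>l\<in>UNIV. X l * (\<Sum>a\<in>UNIV. g_low L j a z * g_inv L a l z))"
    by (subst sum.swap) (simp add: sum_distrib_left)
  finally show ?thesis
    by (simp only: g_low_g_inv[OF assms] sum_kronecker X_def)
qed

text \<open>
  For an isotropic metric this is the compatibility of the Levi-Civita connection with \<open>g\<close>; hence
  the mean Landsberg tensor vanishes.
\<close>

lemma nabla_g_eq_0:
  assumes "z \<in> U"
  shows "nabla_g L k i j z = 0"
proof -
  have dyN: "dy i (canonical_conn L k a) z = christoffel L a k i z" for i a
    using dy_fibre_linear[OF open_U assms differentiable_canonical_conn canonical_conn_fibre_linear] assms by blast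
  have "delta (canonical_conn L) k (g_low L i j) z = dx k (g_low L i j) z"
    using dy_isotropic[OF open_U assms differentiable_g_low isotropic_g_low] assms by (simp add: delta_def)
  moreover have "(\<Sum>a\<in>UNIV. christoffel L a k j z * g_low L i a z) = (\<Sum>a\<in>UNIV. christoffel L a k j z * g_low L a i z)"
    by (simp only: g_low_sym[OF assms, of i])
  ultimately have "nabla_g L k i j z = dx k (g_low L i j) z
      - 1 / 2 * (dx k (g_low L j i) z + dx i (g_low L j k) z - dx j (g_low L k i) z)
      - 1 / 2 * (dx k (g_low L i j) z + dx j (g_low L i k) z - dx i (g_low L k j) z)"
    unfolding nabla_g_def dyN by (simp only: christoffel_lower[OF assms])
  then show ?thesis
    using dx_g_low_sym[OF assms, of k j i] dx_g_low_sym[OF assms, of i j k]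
      dx_g_low_sym[OF assms, of j k i] by argo
qed

lemma mean_Landsberg_eq_0: "z \<in> U \<Longrightarrow> mean_Landsberg L i z = 0"
  by (simp add: mean_Landsberg_def nabla_g_eq_0)

end

section \<open>The Ricci scalar of a linear connection\<close>

text \<open>
  Adding \<open>\<alpha>\<^sub>i(x) y\<^sup>k\<close> to a connection that is \<open>1\<close>-homogeneous in \<open>y\<close> changes \<open>\<delta>\<^sub>j N\<^sub>i\<^sup>k\<close> by
  \<open>\<partial>\<^sub>j\<alpha>\<^sub>i y\<^sup>k\<close> and by terms symmetric in \<open>i\<close> and \<open>j\<close>. The curvature therefore changes by
  \<open>(\<partial>\<^sub>j\<alpha>\<^sub>i - \<partial>\<^sub>i\<alpha>\<^sub>j) y\<^sup>k\<close>, and the Ricci scalar by \<open>(\<partial>\<^sub>j\<alpha>\<^sub>i - \<partial>\<^sub>i\<alpha>\<^sub>j) y\<^sup>i y\<^sup>j = 0\<close>.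
\<close>

lemma Ric_add_liouville:
  assumes U: "open U"
    and N0: "\<And>i k z. z \<in> U \<Longrightarrow> N0 i k differentiable (at z)"
    and lin: "\<And>i k. fibre_linear U (N0 i k) (G i k)"
    and \<alpha>: "\<And>i z. z \<in> U \<Longrightarrow> \<alpha> i differentiable (at z)"
    and iso: "\<And>i. isotropic_on U (\<alpha> i)"
    and N: "\<And>i k z. z \<in> U \<Longrightarrow> N i k z = N0 i k z + \<alpha> i z * snd z $ k"
    and z: "z \<in> U"
  shows "Ric N z = Ric N0 z"
proof -
  have dxN: "dx j (N i k) z = dx j (N0 i k) z + dx j (\<alpha> i) z * snd z $ k"
    and dyN: "dy j (N i k) z = dy j (N0 i k) z + \<alpha> i z * kronecker j k" for i j k
  proof -
    have diff: "(\<lambda>z. N0 i k z + \<alpha> i z * snd z $ k) differentiable (at z)"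
      using z by (intro differentiable_add differentiable_mult N0 \<alpha> differentiable_snd_nth)
    have "dx j (N i k) z = dx j (\<lambda>z. N0 i k z + \<alpha> i z * snd z $ k) z"
      by (rule dx_cong[OF U z diff, symmetric]) (simp add: N)
    then show "dx j (N i k) z = dx j (N0 i k) z + dx j (\<alpha> i) z * snd z $ k"
      using N0 \<alpha> z by (simp add: dx_add dx_mult)
    have "dy j (N i k) z = dy j (\<lambda>z. N0 i k z + \<alpha> i z * snd z $ k) z"
      by (rule dy_cong[OF U z diff, symmetric]) (simp add: N)
    then show "dy j (N i k) z = dy j (N0 i k) z + \<alpha> i z * kronecker j k"
      using N0 \<alpha> z dy_isotropic[OF U z \<alpha> iso] by (simp add: dy_add dy_mult)
  qed
  have euler: "(\<Sum>a\<in>UNIV. snd z $ a * dy a (N0 i k) z) = N0 i k z" for i k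
    using dy_fibre_linear[OF U z N0 lin] lin z by (simp add: fibre_linear_def mult.commute)
  have delta: "delta N j (N i k) z = delta N0 j (N0 i k) z + dx j (\<alpha> i) z * snd z $ k
      - (\<alpha> i z * N0 j k z + \<alpha> j z * N0 i k z) - \<alpha> i z * \<alpha> j z * snd z $ k" for i j k
  proof -
    have "(\<Sum>a\<in>UNIV. N j a z * dy a (N i k) z)
        = (\<Sum>a\<in>UNIV. N0 j a z * dy a (N0 i k) z + \<alpha> i z * (N0 j a z * kronecker a k)
            + \<alpha> j z * (snd z $ a * dy a (N0 i k) z) + \<alpha> i z * \<alpha> j z * (snd z $ a * kronecker a k))"
      unfolding dyN N[OF z] by (intro sum.cong refl) (simp add: algebra_simps)
    also have "\<dots> = (\<Sum>a\<in>UNIV. N0 j a z * dy a (N0 i k) z) + \<alpha> i z * N0 j k z + \<alpha> j z * N0 i k z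
        + \<alpha> i z * \<alpha> j z * snd z $ k"
      by (simp only: sum.distrib sum_distrib_left[symmetric] sum_kronecker euler)
    finally show ?thesis
      by (simp add: delta_def dxN)
  qed
  have curv: "curvature N i j k z = curvature N0 i j k z + (dx j (\<alpha> i) z - dx i (\<alpha> j) z) * snd z $ k" for i j k
    by (simp add: curvature_def delta algebra_simps)
  have "Ric N z = Ric N0 z + ((\<Sum>a\<in>UNIV. \<Sum>b\<in>UNIV. dx a (\<alpha> b) z * snd z $ a * snd z $ b)
      - (\<Sum>a\<in>UNIV. \<Sum>b\<in>UNIV. dx b (\<alpha> a) z * snd z $ b * snd z $ a))"
    by (simp add: Ric_def curv sum.distrib sum_subtractf algebra_simps)
  also have "(\<Sum>a\<in>UNIV. \<Sum>b\<in>UNIV. dx b (\<alpha> a) z * snd z $ b * snd z $ a)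
      = (\<Sum>a\<in>UNIV. \<Sum>b\<in>UNIV. dx a (\<alpha> b) z * snd z $ a * snd z $ b)"
    by (rule sum.swap)
  finally show ?thesis
    by simp
qed

text \<open>
  The coefficients \<open>\<Gamma>\<close> are taken to be the vertical derivatives of the connection and not the given
  \<open>G\<close>, with which they agree on \<open>U\<close>: in this form they inherit smoothness, and the base derivatives
  of the connection can be computed from theirs. \<open>E\<close> collects the coefficients of \<open>\<delta>\<^sub>j N\<^sub>i\<^sup>k\<close>.
\<close>

lemma Ric_fibre_quadratic:
  assumes U: "open U"
    and N: "\<And>i k. smooth_on U (N i k)"
    and lin: "\<And>i k. fibre_linear U (N i k) (G i k)"
  obtains r where "\<And>b c. isotropic_on U (r b c)"
    and "\<And>z. z \<in> U \<Longrightarrow> Ric N z = (\<Sum>b\<in>UNIV. \<Sum>c\<in>UNIV. r b c z * snd z $ b * snd z $ c)"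
proof -
  define \<Gamma> where "\<Gamma> i k c = dy c (N i k)" for i k c
  have \<Gamma>_G: "\<Gamma> i k c z = G i k c z" if "z \<in> U" for i k c z
    unfolding \<Gamma>_def by (rule dy_fibre_linear[OF U that smooth_on_differentiable[OF N that] lin])
  have \<Gamma>_diff: "\<Gamma> i k c differentiable (at z)" if "z \<in> U" for i k c z
    unfolding \<Gamma>_def using smooth_on_dy[OF N] that by (rule smooth_on_differentiable)
  have \<Gamma>_iso: "isotropic_on U (\<Gamma> i k c)" for i k c
  proof (rule isotropic_onI)
    fix x y y' assume *: "(x, y) \<in> U" "(x, y') \<in> U"
    have "G i k c (x, y) = G i k c (x, y')"
      using lin[of i k] * unfolding fibre_linear_def by (blast intro: isotropic_onD)
    then show "\<Gamma> i k c (x, y) = \<Gamma> i k c (x, y')"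
      using \<Gamma>_G * by simp
  qed
  have N_\<Gamma>: "N i k z = (\<Sum>c\<in>UNIV. \<Gamma> i k c z * snd z $ c)" if "z \<in> U" for i k z
    using lin[of i k] that by (simp add: fibre_linear_def \<Gamma>_G)
  have dxN: "dx j (N i k) z = (\<Sum>c\<in>UNIV. dx j (\<Gamma> i k c) z * snd z $ c)" if z: "z \<in> U" for i j k z
  proof -
    have "dx j (N i k) z = dx j (\<lambda>z. \<Sum>c\<in>UNIV. \<Gamma> i k c z * snd z $ c) z"
      by (rule dx_cong[OF U z smooth_on_differentiable[OF N z] N_\<Gamma>])
    also have "\<dots> = (\<Sum>c\<in>UNIV. dx j (\<lambda>z. \<Gamma> i k c z * snd z $ c) z)"
      using \<Gamma>_diff[OF z] by (intro dx_sum differentiable_mult differentiable_snd_nth)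
    finally show ?thesis
      using \<Gamma>_diff[OF z] by (simp add: dx_mult)
  qed
  define E where "E j i k c z = dx j (\<Gamma> i k c) z - (\<Sum>d\<in>UNIV. \<Gamma> j d c z * \<Gamma> i k d z)" for j i k c z
  have delta: "delta N j (N i k) z = (\<Sum>c\<in>UNIV. E j i k c z * snd z $ c)" if z: "z \<in> U" for i j k z
  proof -
    have "(\<Sum>d\<in>UNIV. N j d z * \<Gamma> i k d z) = (\<Sum>c\<in>UNIV. (\<Sum>d\<in>UNIV. \<Gamma> j d c z * \<Gamma> i k d z) * snd z $ c)"
      unfolding N_\<Gamma>[OF z] sum_distrib_right by (subst sum.swap) (simp add: mult_ac)
    then show ?thesis
      by (simp add: delta_def dxN[OF z] E_def sum_subtractf left_diff_distrib flip: \<Gamma>_def)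
  qed
  define r where "r b c z = (\<Sum>a\<in>UNIV. E a b a c z - E b a a c z)" for b c z
  show thesis
  proof
    fix b c
    show "isotropic_on U (r b c)"
    proof (rule isotropic_onI)
      fix x y y' assume *: "(x, y) \<in> U" "(x, y') \<in> U"
      have "E j i k c (x, y) = E j i k c (x, y')" for j i k c
      proof -
        have "isotropic_on U (dx j (\<Gamma> i k c))"
          by (rule dx_isotropic[OF U \<Gamma>_diff \<Gamma>_iso])
        from isotropic_onD[OF this *] show ?thesis
          unfolding E_def isotropic_onD[OF \<Gamma>_iso *] by simp
      qed
      then show "r b c (x, y) = r b c (x, y')"
        by (simp add: r_def)
    qed
  next
    fix z assume z: "z \<in> U"
    have "Ric N z = (\<Sum>a\<in>UNIV. \<Sum>b\<in>UNIV. \<Sum>c\<in>UNIV. (E a b a c z - E b a a c z) * snd z $ b * snd z $ c)"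
      by (simp add: Ric_def curvature_def delta[OF z] sum_distrib_left sum_subtractf algebra_simps)
    also have "\<dots> = (\<Sum>b\<in>UNIV. \<Sum>a\<in>UNIV. \<Sum>c\<in>UNIV. (E a b a c z - E b a a c z) * snd z $ b * snd z $ c)"
      by (rule sum.swap)
    also have "\<dots> = (\<Sum>b\<in>UNIV. \<Sum>c\<in>UNIV. \<Sum>a\<in>UNIV. (E a b a c z - E b a a c z) * snd z $ b * snd z $ c)"
      by (intro sum.cong refl sum.swap)
    finally show "Ric N z = (\<Sum>b\<in>UNIV. \<Sum>c\<in>UNIV. r b c z * snd z $ b * snd z $ c)"
      by (simp only: r_def sum_distrib_right)
  qed
qed

lemma smooth_on_Ric:
  assumes "open U" "\<And>i k. smooth_on U (N i k)"
  shows "smooth_on U (Ric N)"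
  unfolding Ric_def[abs_def] curvature_def delta_def
  by (intro smooth_on_sum smooth_on_mult smooth_on_diff smooth_on_dx smooth_on_dy smooth_on_snd_nth assms)

section \<open>The field equations in a chart\<close>

context pseudo_riemannian_chart
begin

lemma metric_expr_eq_0_iff:
  assumes dim: "CARD('n) \<ge> 3"
    and N: "\<And>i k. smooth_on U (N i k)"
    and lin: "\<And>i k. fibre_linear U (N i k) (G i k)"
  shows "(\<forall>z\<in>U. metric_expr L N z = 0) \<longleftrightarrow> (\<forall>z\<in>U. Ric N z = 0)"
proof
  have smooth_Ric: "smooth_on U (Ric N)"
    using open_U N by (rule smooth_on_Ric)
  {
    assume flat: "\<forall>z\<in>U. Ric N z = 0"
    have "dy a (Ric N) z = dy a (\<lambda>z. 0) z" if "z \<in> U" for a z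
      by (rule dy_cong[OF open_U that smooth_on_differentiable[OF smooth_Ric that]]) (simp add: flat)
    then have "dy b (dy a (Ric N)) z = dy b (\<lambda>z. 0) z" if "z \<in> U" for a b z
      by (intro dy_cong[OF open_U that smooth_on_differentiable[OF smooth_on_dy[OF smooth_Ric] that]])
        (simp add: that)
    then show "\<forall>z\<in>U. metric_expr L N z = 0"
      using flat by (simp add: metric_expr_def)
  next
    assume metric: "\<forall>z\<in>U. metric_expr L N z = 0"
    obtain r where iso: "\<And>b c. isotropic_on U (r b c)"
      and Ric: "\<And>z. z \<in> U \<Longrightarrow> Ric N z = (\<Sum>b\<in>UNIV. \<Sum>c\<in>UNIV. r b c z * snd z $ b * snd z $ c)"
      by (rule Ric_fibre_quadratic[where N = N and G = G, OF open_U N lin]) (rule that, assumption+)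
    have dyRic: "dy a (Ric N) z = (\<Sum>b\<in>UNIV. (r a b z + r b a z) * snd z $ b)" if "z \<in> U" for a z
      using dy_fibre_quadratic[OF open_U _ _ iso Ric, of "fst z" "snd z"] that
        smooth_on_differentiable[OF smooth_Ric that] by simp
    have dydyRic: "dy b (dy a (Ric N)) z = r a b z + r b a z" if "z \<in> U" for a b z
    proof (rule dy_fibre_linear[OF open_U that smooth_on_differentiable[OF smooth_on_dy[OF smooth_Ric] that]])
      have "isotropic_on U (\<lambda>z. r a b z + r b a z)" for b
        by (rule isotropic_onI) (metis isotropic_onD[OF iso])
      then show "fibre_linear U (dy a (Ric N)) (\<lambda>b z. r a b z + r b a z)"
        by (simp add: fibre_linear_def dyRic)
    qed
    show "\<forall>z\<in>U. Ric N z = 0"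
    proof
      fix z assume zU: "z \<in> U"
      obtain x y where z: "z = (x, y)" by (cases z)
      let ?V = "{y. (x, y) \<in> U}"
      have "(\<Sum>a\<in>UNIV. \<Sum>b\<in>UNIV. r a b z * y $ a * y $ b) = 0"
      proof (rule ricci_flat_of_metric_equation[where V = ?V and g = "\<lambda>i j. g_low L i j z"
            and h = "\<lambda>i j. g_inv L i j z", OF dim open_fibre[OF open_U]])
        show "y \<in> ?V"
          using zU z by simp
        show "g_low L i j z = g_low L j i z" for i j
          by (rule g_low_sym[OF zU])
        show "(\<Sum>k\<in>UNIV. g_inv L i k z * g_low L k j z) = kronecker i j" for i j
          by (rule g_inv_g_low[OF zU])
        fix y' assume "y' \<in> ?V"
        then have y': "(x, y') \<in> U"
          by simp
        have eq: "g_low L i j (x, y') = g_low L i j z" "g_inv L i j (x, y') = g_inv L i j z"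
          "r i j (x, y') = r i j z" for i j
          using isotropic_onD[OF isotropic_g_low y'] isotropic_onD[OF isotropic_g_inv y']
            isotropic_onD[OF iso y'] zU z by blast+
        have "metric_expr L N (x, y') = 0"
          using metric y' by blast
        then show "(real CARD('n) + 2) * (\<Sum>a\<in>UNIV. \<Sum>b\<in>UNIV. r a b z * y' $ a * y' $ b)
          - (\<Sum>a\<in>UNIV. \<Sum>b\<in>UNIV. g_low L a b z * y' $ a * y' $ b)
            * (\<Sum>a\<in>UNIV. \<Sum>b\<in>UNIV. g_inv L a b z * (r a b z + r b a z)) = 0"
          unfolding metric_expr_def Ric[OF y'] L_eq[OF y'] dydyRic[OF y'] eq
          by (simp add: add.commute)
      qed
      then show "Ric N z = 0"
        using Ric[OF zU] z by simp
    qed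
  }
qed

text \<open>Brings the affine equation into the form solved on a single fibre.\<close>

lemma affine_expr_fibre_linear:
  assumes z: "z \<in> U"
    and J: "\<And>i k. smooth_on U (J i k)"
    and lin: "\<And>i k. fibre_linear U (J i k) (G i k)"
  defines "T \<equiv> \<lambda>b. (real CARD('n) + 2) * ((\<Sum>a\<in>UNIV. y_low L a z * J b a z) / L z)
      - (\<Sum>a\<in>UNIV. G b a a z + G a a b z)"
  shows "affine_expr L J i j z = T i * snd z $ j - (\<Sum>b\<in>UNIV. T b * snd z $ b) * kronecker j i
      - (\<Sum>a\<in>UNIV. (G i j a z - G a j i z) * snd z $ a)"
proof -
  have dyJ: "dy a (J i k) z = G i k a z" for i k a
    by (rule dy_fibre_linear[OF open_U z smooth_on_differentiable[OF J z] lin])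
  have "affine_expr L J i j z = (\<Sum>b\<in>UNIV. T b * (kronecker b i * snd z $ j - snd z $ b * kronecker j i))
      - (\<Sum>a\<in>UNIV. (G i j a z - G a j i z) * snd z $ a)"
    unfolding affine_expr_def
    by (simp add: dyJ mean_Landsberg_eq_0[OF z] mean_Cartan_eq_0[OF z] T_def sum_divide_distrib add.commute)
  also have "(\<Sum>b\<in>UNIV. T b * (kronecker b i * snd z $ j - snd z $ b * kronecker j i))
      = (\<Sum>b\<in>UNIV. kronecker b i * (T b * snd z $ j) - T b * snd z $ b * kronecker j i)"
    by (simp add: algebra_simps)
  also have "\<dots> = T i * snd z $ j - (\<Sum>b\<in>UNIV. T b * snd z $ b) * kronecker j i"
    by (simp only: sum_subtractf sum_kronecker sum_distrib_right)
  finally show ?thesis .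
qed

text \<open>
  The form \<open>\<alpha>\<close> is recovered from \<open>J\<^sub>i\<^sup>k = \<alpha>\<^sub>i y\<^sup>k\<close> as \<open>\<partial>J\<^sub>i\<^sup>a/\<partial>y\<^sup>a = n \<alpha>\<^sub>i\<close>, an expression that is visibly
  smooth; the fibrewise algebra alone provides its values point by point.
\<close>

lemma affine_solution_is_liouville:
  assumes dim: "CARD('n) \<ge> 3"
    and J: "\<And>i k. smooth_on U (J i k)"
    and lin: "\<And>i k. fibre_linear U (J i k) (G i k)"
    and affine: "\<And>i j z. z \<in> U \<Longrightarrow> affine_expr L J i j z = 0"
  defines "\<alpha> \<equiv> \<lambda>i z. 1 / real CARD('n) * (\<Sum>a\<in>UNIV. dy a (J i a) z)"
  shows "isotropic_on U (\<alpha> i)" and "z \<in> U \<Longrightarrow> J i k z = \<alpha> i z * snd z $ k"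
proof -
  have \<alpha>: "\<alpha> i z = 1 / real CARD('n) * (\<Sum>a\<in>UNIV. G i a a z)" if "z \<in> U" for z i
    unfolding \<alpha>_def using dy_fibre_linear[OF open_U that smooth_on_differentiable[OF J that] lin] by simp
  show "isotropic_on U (\<alpha> i)"
  proof (rule isotropic_onI)
    fix x y y' assume *: "(x, y) \<in> U" "(x, y') \<in> U"
    have "G i a a (x, y) = G i a a (x, y')" for a
      using lin[of i a] * unfolding fibre_linear_def by (blast intro: isotropic_onD)
    then show "\<alpha> i (x, y) = \<alpha> i (x, y')"
      using \<alpha> * by simp
  qed
  assume zU: "z \<in> U"
  obtain x y where z: "z = (x, y)" by (cases z)
  let ?V = "{y. (x, y) \<in> U}"
  have "\<exists>B. \<forall>k i a. G i k a z = B i * kronecker k a"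
  proof (rule liouville_of_affine_equation[where V = ?V and g = "\<lambda>i j. g_low L i j z"
        and h = "\<lambda>i j. g_inv L i j z" and J = "\<lambda>k i a. G i k a z", OF dim open_fibre[OF open_U]])
    show "y \<in> ?V"
      using zU z by simp
    show "g_low L i j z = g_low L j i z" for i j
      by (rule g_low_sym[OF zU])
    show "(\<Sum>k\<in>UNIV. g_inv L i k z * g_low L k j z) = kronecker i j"
      "(\<Sum>k\<in>UNIV. g_low L i k z * g_inv L k j z) = kronecker i j" for i j
      by (rule g_inv_g_low[OF zU] g_low_g_inv[OF zU])+
    fix y' assume "y' \<in> ?V"
    then have y': "(x, y') \<in> U"
      by simp
    have eq: "g_low L i j (x, y') = g_low L i j z" for i j
      using isotropic_onD[OF isotropic_g_low y'] zU z by blast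
    have Geq: "G i k a (x, y') = G i k a z" for i k a
      using lin[of i k] y' zU z unfolding fibre_linear_def by (blast intro: isotropic_onD)
    have Leq: "L (x, y') = (\<Sum>a\<in>UNIV. \<Sum>b\<in>UNIV. g_low L a b z * y' $ a * y' $ b)"
      using L_eq[OF y'] by (simp add: eq)
    have Jeq: "J i k (x, y') = (\<Sum>m\<in>UNIV. G i k m z * y' $ m)" for i k
      using lin[of i k] y' by (simp add: fibre_linear_def Geq)
    show "0 < (\<Sum>a\<in>UNIV. \<Sum>b\<in>UNIV. g_low L a b z * y' $ a * y' $ b)"
      using pos_L[OF y'] Leq by simp
    fix i j
    show "((real CARD('n) + 2) * ((\<Sum>a\<in>UNIV. (\<Sum>m\<in>UNIV. g_low L a m z * y' $ m) * (\<Sum>m\<in>UNIV. G i a m z * y' $ m))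
          / (\<Sum>a\<in>UNIV. \<Sum>b\<in>UNIV. g_low L a b z * y' $ a * y' $ b)) - (\<Sum>a\<in>UNIV. G i a a z + G a a i z)) * y' $ j
      - (\<Sum>b\<in>UNIV. ((real CARD('n) + 2) * ((\<Sum>a\<in>UNIV. (\<Sum>m\<in>UNIV. g_low L a m z * y' $ m) * (\<Sum>m\<in>UNIV. G b a m z * y' $ m))
          / (\<Sum>a\<in>UNIV. \<Sum>b\<in>UNIV. g_low L a b z * y' $ a * y' $ b)) - (\<Sum>a\<in>UNIV. G b a a z + G a a b z)) * y' $ b) * kronecker j i
      = (\<Sum>a\<in>UNIV. (G i j a z - G a j i z) * y' $ a)"
      using affine[OF y', of i j] unfolding affine_expr_fibre_linear[where J = J and G = G, OF y' J lin]
      by (simp only: y_low_def Jeq Leq eq Geq snd_conv right_minus_eq)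
  qed
  then obtain B where B: "\<And>k i a. G i k a z = B i * kronecker k a"
    by blast
  have "\<alpha> i z = B i"
    using dim by (simp add: \<alpha>[OF zU] B kronecker_def)
  moreover have "J i k z = B i * snd z $ k"
    using lin[of i k] zU by (simp add: fibre_linear_def B mult.assoc flip: sum_distrib_left)
  ultimately show "J i k z = \<alpha> i z * snd z $ k"
    by simp
qed

text \<open>
  For \<open>J\<^sub>i\<^sup>k = \<alpha>\<^sub>i y\<^sup>k\<close> the brace of the affine equation is \<open>(n + 2) \<alpha>\<^sub>b - (n + 1) \<alpha>\<^sub>b = \<alpha>\<^sub>b\<close>, and the two
  remaining terms cancel.
\<close>

lemma affine_expr_liouville:
  assumes z: "z \<in> U"
    and \<alpha>: "\<And>i. smooth_on U (\<alpha> i)"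
    and iso: "\<And>i. isotropic_on U (\<alpha> i)"
  shows "affine_expr L (\<lambda>i k z. \<alpha> i z * snd z $ k) i j z = 0"
proof -
  let ?J = "\<lambda>i k z. \<alpha> i z * snd z $ k"
  define G where "G i k a z = \<alpha> i z * kronecker k a" for i k a :: 'n and z
  have lin: "fibre_linear U (?J i k) (G i k)" for i k
  proof -
    have "isotropic_on U (G i k a)" for a
      unfolding G_def by (rule isotropic_onI) (metis isotropic_onD[OF iso])
    then show ?thesis
      by (simp add: fibre_linear_def G_def mult.assoc flip: sum_distrib_left)
  qed
  have smooth: "smooth_on U (?J i k)" for i k
    by (intro smooth_on_mult open_U \<alpha> smooth_on_snd_nth)
  have y_J: "(\<Sum>a\<in>UNIV. y_low L a z * (\<alpha> b z * snd z $ a)) / L z = \<alpha> b z" for b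
  proof -
    have "(\<Sum>a\<in>UNIV. y_low L a z * (\<alpha> b z * snd z $ a)) = \<alpha> b z * (\<Sum>a\<in>UNIV. y_low L a z * snd z $ a)"
      by (simp add: sum_distrib_left mult_ac)
    then show ?thesis
      using pos_L[OF z] by (simp add: y_low_contract[OF z])
  qed
  have trace: "(\<Sum>a\<in>UNIV. G b a a z + G a a b z) = (real CARD('n) + 1) * \<alpha> b z" for b
    by (simp add: G_def sum.distrib algebra_simps) (simp add: kronecker_def[of a a for a])
  have T: "(real CARD('n) + 2) * ((\<Sum>a\<in>UNIV. y_low L a z * (\<alpha> b z * snd z $ a)) / L z)
      - (\<Sum>a\<in>UNIV. G b a a z + G a a b z) = \<alpha> b z" for b
    unfolding y_J trace by (simp add: algebra_simps)
  have "(\<Sum>a\<in>UNIV. (G i j a z - G a j i z) * snd z $ a)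
      = (\<Sum>a\<in>UNIV. \<alpha> i z * (kronecker j a * snd z $ a) - \<alpha> a z * snd z $ a * kronecker j i)"
    by (simp add: G_def algebra_simps)
  also have "\<dots> = \<alpha> i z * snd z $ j - (\<Sum>b\<in>UNIV. \<alpha> b z * snd z $ b) * kronecker j i"
    by (simp only: sum_subtractf sum_kronecker sum_distrib_left[symmetric] sum_distrib_right)
  finally show ?thesis
    unfolding affine_expr_fibre_linear[where J = ?J and G = G, OF z smooth lin] T by simp
qed

end

section \<open>From the charts to the manifold\<close>

lemma over_iff: "w \<in> over A c \<longleftrightarrow> w \<in> A \<and> fst w \<in> fst c"
  by (simp add: over_def)

text \<open>
  A tangent vector is determined by its coordinates in one chart: the Jacobians give those in the
  other charts around its base point, and the remaining entries are \<open>0\<close> by convention.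
\<close>

lemma inj_on_tchart:
  assumes M: "smooth_manifold X At" and A: "conic_domain X At A" and c: "c \<in> At"
  shows "inj_on (tchart c) (over A c)"
proof (rule inj_onI)
  fix w w' assume w: "w \<in> over A c" and w': "w' \<in> over A c" and eq: "tchart c w = tchart c w'"
  have "homeomorphic_map (subtopology X (fst c)) (top_of_set (snd c ` fst c)) (snd c)"
    and "openin X (fst c)"
    using M c by (auto simp: smooth_manifold_def)
  then have "inj_on (snd c) (fst c)"
    using homeomorphic_imp_injective_map openin_subset by (metis topspace_subtopology_subset)
  then have p: "fst w = fst w'"
    using eq w w' by (auto simp: tchart_def over_iff dest: inj_onD)
  have tangent: "snd w \<in> tangent_space At (fst w)" "snd w' \<in> tangent_space At (fst w)"
    using A w w' p by (auto simp: conic_domain_def tangent_bundle_def over_iff mem_Sigma_iff)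
  have "snd w d = snd w' d" for d
  proof (cases "d \<in> At \<and> fst w \<in> fst d")
    case True
    then have "snd w d $ k = snd w' d $ k" for k
      using tangent eq c w unfolding tangent_space_def over_iff tchart_def by simp
    then show ?thesis
      by (simp add: vec_eq_iff)
  next
    case False
    then have "snd w d = 0" "snd w' d = 0"
      using tangent unfolding tangent_space_def by blast+
    then show ?thesis
      by simp
  qed
  then show "w = w'"
    using p by (simp add: prod_eq_iff fun_eq_iff)
qed

lemma snd_tangent_transform:
  assumes A: "conic_domain X At A" and "c \<in> At" "d \<in> At" "w \<in> over A c" "w \<in> over A d"
  shows "snd w d $ k = (\<Sum>m\<in>UNIV. jac c d k m (snd c (fst w)) * snd w c $ m)"
proof -
  have "snd w \<in> tangent_space At (fst w)"
    using A assms(4) by (auto simp: conic_domain_def tangent_bundle_def over_iff)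
  then show ?thesis
    using assms unfolding tangent_space_def over_iff by blast
qed

text \<open>A vector with vanishing coordinates in one chart would lie in the zero section.\<close>

lemma snd_nonzero:
  assumes A: "conic_domain X At A" and d: "d \<in> At" and w: "w \<in> over A d"
  shows "snd w d \<noteq> 0"
proof
  assume 0: "snd w d = 0"
  have tangent: "snd w \<in> tangent_space At (fst w)" "fst w \<in> topspace X" "w \<notin> zero_section X"
    using A w by (auto simp: conic_domain_def tangent_bundle_def over_iff)
  have "snd w c = 0" for c
  proof (cases "c \<in> At \<and> fst w \<in> fst c")
    case True
    then have "w \<in> over A c"
      using w by (simp add: over_iff)
    then have "snd w c $ k = 0" for k
      using snd_tangent_transform[OF A d _ w, of c k] True 0 by simp
    then show ?thesis
      by (simp add: vec_eq_iff)
  next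
    case False
    then show ?thesis
      using tangent(1) unfolding tangent_space_def by blast
  qed
  then have "w = (fst w, \<lambda>_. 0)"
    by (simp add: prod_eq_iff fun_eq_iff)
  then show False
    using tangent(2,3) unfolding zero_section_def by blast
qed

lemma coords_conic:
  assumes A: "conic_domain X At A" and w: "w \<in> over A c" and t: "t > 0"
  shows "tscale t w \<in> over A c" and "tchart c (tscale t w) = (snd c (fst w), t *\<^sub>R snd w c)"
  using assms by (auto simp: conic_domain_def over_iff tscale_def tchart_def)

lemma pseudo_riemannian_chart_coords:
  assumes M: "smooth_manifold X At" and A: "conic_domain X At A" and F: "pseudo_Finsler At A L"
    and pos: "\<forall>w\<in>A. L w > 0" and R: "pseudo_Riemannian At A L" and c: "c \<in> At"
  shows "pseudo_riemannian_chart (coords A c) (local_rep A L c)"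
proof -
  have rep: "local_rep A L c (tchart c w) = L w" if "w \<in> over A c" for w
    unfolding local_rep_def using inj_on_tchart[OF M A c] that by simp
  show ?thesis
  proof
    show "open (coords A c)"
      using A c by (auto simp: conic_domain_def)
    show "smooth_on (coords A c) (local_rep A L c)"
      using F c by (auto simp: pseudo_Finsler_def)
    show "(x, t *\<^sub>R y) \<in> coords A c" and "local_rep A L c (x, t *\<^sub>R y) = t ^ 2 * local_rep A L c (x, y)"
      if xy: "(x, y) \<in> coords A c" and t: "t > 0" for x y and t :: real
    proof -
      obtain w where w: "w \<in> over A c" and xyw: "(x, y) = tchart c w"
        using xy by (auto simp: coords_def)
      have scale: "(x, t *\<^sub>R y) = tchart c (tscale t w)"
        using coords_conic(2)[OF A w t] xyw by (simp add: tchart_def)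
      show "(x, t *\<^sub>R y) \<in> coords A c"
        unfolding scale coords_def using coords_conic(1)[OF A w t] by blast
      have "L (tscale t w) = t powr 2 * L w"
        using F w t by (auto simp: pseudo_Finsler_def over_iff)
      then show "local_rep A L c (x, t *\<^sub>R y) = t ^ 2 * local_rep A L c (x, y)"
        using t unfolding scale unfolding xyw by (simp add: rep[OF w] rep[OF coords_conic(1)[OF A w t]])
    qed
    show "local_rep A L c z > 0" if "z \<in> coords A c" for z
      using that pos rep by (auto simp: coords_def over_iff)
    show "invertible (g_matrix (local_rep A L c) z)" if "z \<in> coords A c" for z
      using F c that by (auto simp: pseudo_Finsler_def)
    show "g_matrix (local_rep A L c) (x, y) = g_matrix (local_rep A L c) (x, y')"
      if "(x, y) \<in> coords A c" "(x, y') \<in> coords A c" for x y y'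
      using R c that unfolding pseudo_Riemannian_def isotropic_def by blast
  qed
qed

lemma linear_connection_fibre_linear:
  fixes At :: "('p, 'n::finite) chart set"
  assumes "linear_connection At A N" "c \<in> At"
  obtains G where "\<And>i k. fibre_linear (coords A c) (N c i k) (G i k)"
proof -
  obtain \<Gamma> :: "'n \<Rightarrow> 'n \<Rightarrow> 'n \<Rightarrow> real^'n \<Rightarrow> real"
    where \<Gamma>: "\<forall>(x, y) \<in> coords A c. \<forall>i k. N c i k (x, y) = (\<Sum>a\<in>UNIV. \<Gamma> k i a x * y $ a)"
    using assms unfolding linear_connection_def by blast
  have "fibre_linear (coords A c) (N c i k) (\<lambda>a z. \<Gamma> k i a (fst z))" for i k
    unfolding fibre_linear_def
  proof (intro conjI allI ballI)
    show "isotropic_on (coords A c) (\<lambda>z. \<Gamma> k i a (fst z))" for a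
      by (rule isotropic_onI) simp
    show "N c i k z = (\<Sum>a\<in>UNIV. \<Gamma> k i a (fst z) * snd z $ a)" if "z \<in> coords A c" for z
      using bspec[OF \<Gamma> that] by (simp add: case_prod_beta)
  qed
  then show thesis
    by (rule that)
qed

lemma isotropic_one_form_on:
  assumes "isotropic_one_form At A \<alpha>" "c \<in> At"
  shows "smooth_on (coords A c) (\<alpha> c i)" "isotropic_on (coords A c) (\<alpha> c i)"
proof -
  show "smooth_on (coords A c) (\<alpha> c i)"
    using assms unfolding isotropic_one_form_def tensor01_def by blast
  show "isotropic_on (coords A c) (\<alpha> c i)"
  proof (rule isotropic_onI)
    fix x y y' assume "(x, y) \<in> coords A c" "(x, y') \<in> coords A c"
    then have "(\<lambda>i. \<alpha> c i (x, y)) = (\<lambda>i. \<alpha> c i (x, y'))"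
      using assms unfolding isotropic_one_form_def isotropic_def by blast
    then show "\<alpha> c i (x, y) = \<alpha> c i (x, y')"
      by (rule fun_cong)
  qed
qed

lemma homogeneous_tensor_liouville:
  assumes A: "conic_domain X At A" and \<alpha>: "isotropic_one_form At A \<alpha>"
  shows "homogeneous_tensor11 1 At A (tensor_Liouville \<alpha>)"
  unfolding homogeneous_tensor11_def tensor11_def
proof (intro conjI ballI allI)
  fix c i k assume c: "c \<in> At"
  have op: "open (coords A c)"
    using A c by (auto simp: conic_domain_def)
  show "smooth_on (coords A c) (tensor_Liouville \<alpha> c i k)"
    unfolding tensor_Liouville_def[abs_def]
    by (intro smooth_on_mult op isotropic_one_form_on(1)[OF \<alpha> c] smooth_on_snd_nth)
  show "positively_homogeneous 1 (coords A c) (tensor_Liouville \<alpha> c i k)"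
    unfolding positively_homogeneous_def
  proof clarify
    fix x y and t :: real assume xy: "(x, y) \<in> coords A c" and t: "t > 0"
    obtain w where w: "w \<in> over A c" and xyw: "(x, y) = tchart c w"
      using xy by (auto simp: coords_def)
    have "(x, t *\<^sub>R y) = tchart c (tscale t w)"
      using coords_conic(2)[OF A w t] xyw by (simp add: tchart_def)
    then have "(x, t *\<^sub>R y) \<in> coords A c"
      unfolding coords_def using coords_conic(1)[OF A w t] by blast
    then have "\<alpha> c i (x, t *\<^sub>R y) = \<alpha> c i (x, y)"
      using isotropic_onD[OF isotropic_one_form_on(2)[OF \<alpha> c]] xy by blast
    then show "tensor_Liouville \<alpha> c i k (x, t *\<^sub>R y) = t powr 1 * tensor_Liouville \<alpha> c i k (x, y)"
      using t by (simp add: tensor_Liouville_def)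
  qed
next
  fix c d w i k assume c: "c \<in> At" and d: "d \<in> At" and w: "w \<in> over A c \<inter> over A d"
  have "\<alpha> d i (tchart d w) = (\<Sum>a\<in>UNIV. jac d c a i (snd d (fst w)) * \<alpha> c a (tchart c w))"
    using \<alpha> c d w unfolding isotropic_one_form_def tensor01_def by blast
  then show "tensor_Liouville \<alpha> d i k (tchart d w) = (\<Sum>m\<in>UNIV. \<Sum>a\<in>UNIV. jac c d k m (snd c (fst w))
      * jac d c a i (snd d (fst w)) * tensor_Liouville \<alpha> c a m (tchart c w))"
    using snd_tangent_transform[OF A c d, of w k] w
    by (simp add: tensor_Liouville_def tchart_def sum_product mult_ac)
qed

text \<open>
  The transformation law of \<open>\<alpha>\<^sub>i y\<^sup>k\<close> contains that of \<open>\<alpha>\<^sub>i\<close> multiplied by \<open>y\<^sup>k\<close>, and one of these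
  components can be cancelled since \<open>y \<noteq> 0\<close> on \<open>A\<close>.
\<close>

lemma tensor01_of_tensor_liouville:
  assumes A: "conic_domain X At A" and J: "tensor11 At A J"
    and smooth: "\<And>c i. c \<in> At \<Longrightarrow> smooth_on (coords A c) (\<alpha> c i)"
    and eq: "\<And>c i k z. c \<in> At \<Longrightarrow> z \<in> coords A c \<Longrightarrow> J c i k z = \<alpha> c i z * snd z $ k"
  shows "tensor01 At A \<alpha>"
  unfolding tensor01_def
proof (intro conjI ballI allI)
  fix c d w i assume c: "c \<in> At" and d: "d \<in> At" and "w \<in> over A c \<inter> over A d"
  then have w: "w \<in> over A c" "w \<in> over A d"
    by auto
  then have z: "tchart c w \<in> coords A c" "tchart d w \<in> coords A d"
    by (auto simp: coords_def)
  obtain k where k: "snd w d $ k \<noteq> 0"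
    using snd_nonzero[OF A d w(2)] by (auto simp: vec_eq_iff)
  have "\<alpha> d i (tchart d w) * snd w d $ k = J d i k (tchart d w)"
    using eq[OF d z(2)] by (simp add: tchart_def)
  also have "\<dots> = (\<Sum>m\<in>UNIV. \<Sum>a\<in>UNIV. jac c d k m (snd c (fst w)) * jac d c a i (snd d (fst w))
      * J c a m (tchart c w))"
    using J c d w unfolding tensor11_def by blast
  also have "\<dots> = (\<Sum>a\<in>UNIV. jac d c a i (snd d (fst w)) * \<alpha> c a (tchart c w)) * snd w d $ k"
    unfolding snd_tangent_transform[OF A c d w] eq[OF c z(1)]
    by (simp add: tchart_def sum_product mult_ac)
  finally show "\<alpha> d i (tchart d w) = (\<Sum>a\<in>UNIV. jac d c a i (snd d (fst w)) * \<alpha> c a (tchart c w))"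
    using k by simp
qed (rule smooth)

theorem theorem5p20:
  fixes X :: "'p topology"
    and At :: "('p, 'n::finite) chart set"
    and A :: "('p, 'n) tvec set"
    and L :: "('p, 'n) tvec \<Rightarrow> real"
    and N :: "('p, 'n) chart \<Rightarrow> 'n field11"
  assumes "CARD('n) \<ge> 3"
    and "smooth_manifold X At" and "connected_space X"
    and "conic_domain X At A"
    and "pseudo_Finsler At A L" and "\<forall>w\<in>A. L w > 0" and "pseudo_Riemannian At A L"
    and "nonlinear_connection At A N" and "linear_connection At A N"
  shows "(solves_affine At A L N \<longleftrightarrow>
           (\<exists>\<A>. isotropic_one_form At A \<A> \<and>
              agree At A N (\<lambda>c i k z. conn_of A L c i k z + tensor_Liouville \<A> c i k z)))
       \<and> (solves_affine At A L N \<longrightarrow>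
           same_Ric At A N (conn_of A L) \<and>
           (solves_metric At A L N \<longleftrightarrow> solves_Einstein At A L))"
proof -
  note A = \<open>conic_domain X At A\<close>
  have patch: "pseudo_riemannian_chart (coords A c) (local_rep A L c)" if "c \<in> At" for c
    using pseudo_riemannian_chart_coords[OF assms(2,4,5,6,7) that] .
  have op: "open (coords A c)" if "c \<in> At" for c
    using pseudo_riemannian_chart.open_U[OF patch[OF that]] .
  have smooth_N: "smooth_on (coords A c) (N c i k)" if "c \<in> At" for c i k
    using assms(8) that by (auto simp: nonlinear_connection_def)
  let ?shifted = "\<lambda>\<A>. isotropic_one_form At A \<A> \<and>
     agree At A N (\<lambda>c i k z. conn_of A L c i k z + tensor_Liouville \<A> c i k z)"
  have liouville: "\<exists>\<A>. ?shifted \<A>" if solves: "solves_affine At A L N"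
  proof -
    obtain J where J: "homogeneous_tensor11 1 At A J"
      and N: "agree At A N (\<lambda>c i k z. conn_of A L c i k z + J c i k z)"
      and affine: "\<And>c z i j. c \<in> At \<Longrightarrow> z \<in> coords A c \<Longrightarrow> affine_expr (local_rep A L c) (J c) i j z = 0"
      using solves unfolding solves_affine_def by blast
    define \<A> where "\<A> c i z = 1 / real CARD('n) * (\<Sum>a\<in>UNIV. dy a (J c i a) z)" for c and i :: 'n and z
    have smooth_J: "smooth_on (coords A c) (J c i k)" if "c \<in> At" for c i k
      using J that by (auto simp: homogeneous_tensor11_def tensor11_def)
    have smooth: "smooth_on (coords A c) (\<A> c i)" if c: "c \<in> At" for c i
      unfolding \<A>_def[abs_def]
      by (intro smooth_on_mult smooth_on_const smooth_on_sum smooth_on_dy smooth_J op c)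
    have local: "isotropic_on (coords A c) (\<A> c i)"
      "\<And>z. z \<in> coords A c \<Longrightarrow> J c i k z = \<A> c i z * snd z $ k" if c: "c \<in> At" for c i k
    proof -
      interpret pseudo_riemannian_chart "coords A c" "local_rep A L c"
        by (rule patch[OF c])
      obtain G where G: "\<And>i k. fibre_linear (coords A c) (N c i k) (G i k)"
        using linear_connection_fibre_linear[OF assms(9) c] by blast
      define H where "H i k a z = G i k a z - christoffel (local_rep A L c) k i a z" for i k a z
      have lin: "fibre_linear (coords A c) (J c i k) (H i k)" for i k
        unfolding fibre_linear_def
      proof (intro conjI allI ballI)
        fix a
        show "isotropic_on (coords A c) (H i k a)"
        proof (rule isotropic_onI)
          fix x y y' assume *: "(x, y) \<in> coords A c" "(x, y') \<in> coords A c"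
          have "G i k a (x, y) = G i k a (x, y')"
            using G[of i k] * unfolding fibre_linear_def by (blast intro: isotropic_onD)
          then show "H i k a (x, y) = H i k a (x, y')"
            unfolding H_def isotropic_onD[OF isotropic_christoffel *] by simp
        qed
      next
        fix z assume z: "z \<in> coords A c"
        have "J c i k z = N c i k z - canonical_conn (local_rep A L c) i k z"
          using N c z by (simp add: agree_def conn_of_def)
        then show "J c i k z = (\<Sum>a\<in>UNIV. H i k a z * snd z $ a)"
          using G[of i k] z
          by (simp add: canonical_conn_eq[OF z] fibre_linear_def H_def left_diff_distrib sum_subtractf)
      qed
      show "isotropic_on (coords A c) (\<A> c i)"
        "\<And>z. z \<in> coords A c \<Longrightarrow> J c i k z = \<A> c i z * snd z $ k"
        unfolding \<A>_def[abs_def]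
        using affine_solution_is_liouville[where J = "J c" and G = H, OF assms(1) smooth_J[OF c] lin affine[OF c]]
        by blast+
    qed
    have "tensor01 At A \<A>"
    proof (rule tensor01_of_tensor_liouville[OF A])
      show "tensor11 At A J"
        using J by (simp add: homogeneous_tensor11_def)
      show "smooth_on (coords A c) (\<A> c i)" if "c \<in> At" for c i
        by (rule smooth[OF that])
    qed (rule local(2))
    moreover have "isotropic At A (\<lambda>c z i. \<A> c i z)"
      unfolding isotropic_def
    proof (intro ballI allI impI ext)
      fix c x y y' i assume "c \<in> At" "(x, y) \<in> coords A c" "(x, y') \<in> coords A c"
      then show "\<A> c i (x, y) = \<A> c i (x, y')"
        using isotropic_onD[OF local(1)] by blast
    qed
    moreover have "agree At A N (\<lambda>c i k z. conn_of A L c i k z + tensor_Liouville \<A> c i k z)"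
      using N local(2) unfolding agree_def tensor_Liouville_def by simp
    ultimately show ?thesis
      unfolding isotropic_one_form_def by blast
  qed
  have solution: "solves_affine At A L N" if shifted: "?shifted \<A>" for \<A>
    unfolding solves_affine_def
  proof (intro exI conjI ballI allI)
    show "homogeneous_tensor11 1 At A (tensor_Liouville \<A>)"
      using homogeneous_tensor_liouville[OF A] shifted by blast
    show "agree At A N (\<lambda>c i k z. conn_of A L c i k z + tensor_Liouville \<A> c i k z)"
      using shifted by blast
    fix c z i j assume c: "c \<in> At" and z: "z \<in> coords A c"
    show "affine_expr (local_rep A L c) (tensor_Liouville \<A> c) i j z = 0"
      using pseudo_riemannian_chart.affine_expr_liouville[OF patch[OF c] z, of "\<A> c"]
        isotropic_one_form_on[of At A \<A> c] shifted c
      by (simp add: tensor_Liouville_def[abs_def])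
  qed
  have same_Ric: "same_Ric At A N (conn_of A L)" if shifted: "?shifted \<A>" for \<A>
    unfolding same_Ric_def
  proof (intro ballI)
    fix c z assume c: "c \<in> At" and z: "z \<in> coords A c"
    interpret pseudo_riemannian_chart "coords A c" "local_rep A L c"
      by (rule patch[OF c])
    have \<A>: "isotropic_one_form At A \<A>"
      using shifted by blast
    show "Ric (N c) z = Ric (conn_of A L c) z"
      unfolding conn_of_def
    proof (rule Ric_add_liouville[OF open_U differentiable_canonical_conn canonical_conn_fibre_linear _ _ _ z])
      show "\<A> c i differentiable (at z)" if "z \<in> coords A c" for i z
        using smooth_on_differentiable[OF isotropic_one_form_on(1)[OF \<A> c] that] .
      show "isotropic_on (coords A c) (\<A> c i)" for i
        by (rule isotropic_one_form_on(2)[OF \<A> c])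
      show "N c i k z = canonical_conn (local_rep A L c) i k z + \<A> c i z * snd z $ k"
        if "z \<in> coords A c" for i k z
        using shifted c that by (simp add: agree_def conn_of_def tensor_Liouville_def)
    qed
  qed
  have "solves_metric At A L N \<longleftrightarrow> (\<forall>c\<in>At. \<forall>z\<in>coords A c. Ric (N c) z = 0)"
    unfolding solves_metric_def
  proof (rule ball_cong[OF refl])
    fix c assume c: "c \<in> At"
    obtain G where G: "\<And>i k. fibre_linear (coords A c) (N c i k) (G i k)"
      using linear_connection_fibre_linear[OF assms(9) c] by blast
    show "(\<forall>z\<in>coords A c. metric_expr (local_rep A L c) (N c) z = 0) \<longleftrightarrow> (\<forall>z\<in>coords A c. Ric (N c) z = 0)"
      by (rule pseudo_riemannian_chart.metric_expr_eq_0_iff[OF patch[OF c] assms(1) smooth_N[OF c] G])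
  qed
  then have "solves_metric At A L N \<longleftrightarrow> solves_Einstein At A L" if "same_Ric At A N (conn_of A L)"
    using that by (simp add: same_Ric_def solves_Einstein_def)
  then show ?thesis
    using liouville solution same_Ric by blast
qed

end
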